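(* There exists a universal $\underline n$ and, for every $\delta>0$, a constant $C=C(\delta)>0$ such that for all $n\ge\underline n$, all $2\le k\le n$, all $\sigma>0$ and all $\theta_0\in\mathbb R^n$ the following holds. Let $Y=\theta_0+\varepsilon$ with $\varepsilon_1,\dots,\varepsilon_n$ i.i.d. $N(0,\sigma^2)$, and let $\widehat\theta^*\in\arg\min_{\theta\in\Theta_n^*(1,k)}\|Y-\theta\|^2$. Then $$\mathbb E_{\theta_0}\|\widehat\theta^*-\theta_0\|^2\le(1+\delta)\inf_{\theta^*\in\Theta_n^*(1,k)}\|\theta^*-\theta_0\|^2+C\sigma^2k\log\log(16n/k).$$
   Context: $\|\cdot\|$ is the Euclidean norm. $\mathcal F_n(1,0,k)$ is the set of functions $f:[0,1]\to\mathbb R$ for which there exist integers $0=n_0\le n_1\le\cdots\le n_k=n$ such that $n_i-n_{i-1}\ge 2$ whenever $n_i>n_{i-1}$, $f$ is affine on each interval $(n_{i-1}/n,n_i/n]$, and $f((n_i/n)_-)=f((n_i/n)_+)$ for all $i\in\{1,\dots,k-1\}$ with $0<n_i<n$. $\mathcal F_n^*(1,k)$ is the set of $f\in\mathcal F_n(1,0,k)$ whose slopes are non-decreasing on $[0,1]$ (convex piecewise linear functions). $\Theta_n^*(1,k)=\{\theta^*\in\mathbb R^n:\theta^*_i=f^*(i/n),\ 1\le i\le n,\text{ for some }f^*\in\mathcal F_n^*(1,k)\}$. The least squares estimator $\widehat\theta^*$ is any (measurable) choice of minimizer. *)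

theory Defs
  imports "HOL-Probability.Probability"
begin

text \<open>
  Since the dimension \<open>n\<close> is quantified inside the theorem, a vector of \<open>\<real>\<^sup>n\<close> is an extensional
  function on \<open>{1..n}\<close>, i.e. a point of the product space below.
\<close>

abbreviation Rn :: "nat \<Rightarrow> (nat \<Rightarrow> real) measure" where
  "Rn n \<equiv> Pi\<^sub>M {1..n} (\<lambda>_. borel)"

definition sq_dist :: "nat \<Rightarrow> (nat \<Rightarrow> real) \<Rightarrow> (nat \<Rightarrow> real) \<Rightarrow> real" where
  "sq_dist n u v = (L2_set (\<lambda>i. u i - v i) {1..n})\<^sup>2"

definition knots :: "nat \<Rightarrow> nat \<Rightarrow> (nat \<Rightarrow> nat) \<Rightarrow> bool" where
  "knots n k N \<longleftrightarrow> N 0 = 0 \<and> N k = n \<and>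
     (\<forall>i\<in>{1..k}. N (i - 1) \<le> N i \<and> (N (i - 1) < N i \<longrightarrow> N i - N (i - 1) \<ge> 2))"

definition affine_with_slope :: "real \<Rightarrow> real set \<Rightarrow> (real \<Rightarrow> real) \<Rightarrow> bool" where
  "affine_with_slope a I f \<longleftrightarrow> (\<exists>b. \<forall>x\<in>I. f x = a * x + b)"

text \<open>
  Functions on \<open>[0,1]\<close> are total functions whose values outside \<open>[0,1]\<close> play no role.
  The slope \<open>a i\<close> of the \<open>i\<close>-th piece is determined by \<open>f\<close> if that piece is nonempty,
  and is unconstrained otherwise.
\<close>

definition piecewise_linear ::
    "nat \<Rightarrow> nat \<Rightarrow> (nat \<Rightarrow> nat) \<Rightarrow> (nat \<Rightarrow> real) \<Rightarrow> (real \<Rightarrow> real) \<Rightarrow> bool" where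
  "piecewise_linear n k N a f \<longleftrightarrow> knots n k N \<and>
     (\<forall>i\<in>{1..k}. affine_with_slope (a i) {real (N (i - 1)) / real n <.. real (N i) / real n} f) \<and>
     (\<forall>i\<in>{1..k-1}. 0 < N i \<and> N i < n \<longrightarrow>
        (\<exists>L. (f \<longlongrightarrow> L) (at_left (real (N i) / real n)) \<and>
             (f \<longlongrightarrow> L) (at_right (real (N i) / real n))))"

text \<open>The class \<open>\<F>\<^sub>n(1,0,k)\<close> and its convex subclass \<open>\<F>\<^sub>n\<^sup>*(1,k)\<close>.\<close>

definition F_class :: "nat \<Rightarrow> nat \<Rightarrow> (real \<Rightarrow> real) set" where
  "F_class n k = {f. \<exists>N a. piecewise_linear n k N a f}"

definition F_star :: "nat \<Rightarrow> nat \<Rightarrow> (real \<Rightarrow> real) set" where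
  "F_star n k = {f \<in> F_class n k.
     \<exists>N a. piecewise_linear n k N a f \<and> mono_on {i \<in> {1..k}. N (i - 1) < N i} a}"

definition Theta_star :: "nat \<Rightarrow> nat \<Rightarrow> (nat \<Rightarrow> real) set" where
  "Theta_star n k = {\<theta> \<in> space (Rn n).
     \<exists>f\<in>F_star n k. \<forall>i\<in>{1..n}. \<theta> i = f (real i / real n)}"

definition is_least_squares ::
    "nat \<Rightarrow> nat \<Rightarrow> ((nat \<Rightarrow> real) \<Rightarrow> (nat \<Rightarrow> real)) \<Rightarrow> bool" where
  "is_least_squares n k T \<longleftrightarrow> T \<in> Rn n \<rightarrow>\<^sub>M Rn n \<and>
     (\<forall>y\<in>space (Rn n). is_arg_min (\<lambda>\<theta>. sq_dist n y \<theta>) (\<lambda>\<theta>. \<theta> \<in> Theta_star n k) (T y))"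

text \<open>The joint law of \<open>n\<close> independent \<open>N(0,\<sigma>\<^sup>2)\<close> variables; \<open>normal_density\<close> takes the
  standard deviation.\<close>

definition gaussian_noise :: "nat \<Rightarrow> real \<Rightarrow> (nat \<Rightarrow> real) measure" where
  "gaussian_noise n \<sigma> = Pi\<^sub>M {1..n} (\<lambda>_. density lborel (normal_density 0 \<sigma>))"

definition observe :: "nat \<Rightarrow> (nat \<Rightarrow> real) \<Rightarrow> (nat \<Rightarrow> real) \<Rightarrow> (nat \<Rightarrow> real)" where
  "observe n \<theta>\<^sub>0 \<epsilon> = (\<lambda>i\<in>{1..n}. \<theta>\<^sub>0 i + \<epsilon> i)"

end

(*
Fix theta in Theta_star. By optimality of the estimator T, |T - theta0|^2 <= |theta - theta0|^2
+ 2 <eps, T - theta>, so everything reduces to <eps, v>^2 <= |v|^2 B with v = T - theta and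
E B <= C sigma^2 k log log(16 n/k). On each affine piece of theta, v is a convex sequence, hence a
line plus nonnegative combinations of hinges (x - t)_+ to the right and (t - x)_+ to the left of a
point c near the middle of the piece. The line is controlled by |v|. The hinges are anchored at
the ends of the piece, which are deterministic, so only their widths are random: on the dyadic
scale 2^b the noise contributes U_b = O(2^(-2b)) times the sum of the squared partial sums W_j,
j <= 2^(b+1), because <eps, (x - t)_+> is itself a sum of partial sums. Only as many pairs (piece, b)
as v has kinks, at most k in all, enter, out of O(k log(16 n/k)) possible ones. The sum of the k
largest U_b is at most k t plus the sum of all excesses (U_b - t)_+, and t of order
sigma^2 log log(16 n/k) makes the expected total excess O(sigma^2 k), with no need for
independence or a maximal inequality.
*)
theory Submission
  imports Defs "HOL-Library.Discrete_Functions"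
begin

text \<open>Nearby hinges are almost collinear, so a combination with arbitrary signs could have a
  small norm and still correlate strongly with the noise. Nonnegative coefficients forbid this: the
  squared norm is at least the sum over dyadic groups of hinges, each group replaced by its total
  weight times the narrowest hinge of its scale, of squared norm at least 2^(3b)/3. Dividing the
  squared sum of the |W_j| by that norm produces the factor 2^(-2b) in U_b. The point c is taken
  away from the ends because a convex sequence of small norm can be very steep at an end, while
  values on both sides of c trap its value and slope there. The threshold comes from a balance. Each
  W_j^2 / j exceeds t by at most 6 sigma^2 exp(-t / (4 sigma^2)) on average, and concavity of ln
  bounds the number of pairs (piece, b) by O(k kappa) with kappa = ln (16 n / k); t = 4 sigma^2 ln
  kappa makes the product O(sigma^2 k). The factor 1 + delta appears because |v| is measured from
  theta: an AM-GM split leaves a small multiple of |v|^2 <= 2 |T - theta0|^2 + 2 |theta - theta0|^2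
  to be absorbed.\<close>

subsection \<open>Hinge functions\<close>

text \<open>The threshold is subtracted from each normalised partial sum separately, so that its
  expectation involves only one-dimensional Gaussians. The weight \<open>12 / 2 ^ b\<close> is the
  one that comes out of \<open>dyadic_block_bound\<close>, and \<open>min m\<close> keeps the
  partial sums inside a piece of length \<open>m\<close>.\<close>

definition excess :: "real \<Rightarrow> nat \<Rightarrow> (nat \<Rightarrow> real) \<Rightarrow> real" where
  "excess t m e = (\<Sum>b | 2 ^ b \<le> m. 12 / 2 ^ b *
     (\<Sum>j\<in>{1..min m (2 ^ Suc b)}. max 0 ((\<Sum>s<j. e s)\<^sup>2 / real j - t)))"

lemma finite_dyadic_scales: "finite {b::nat. 2 ^ b \<le> (m::nat)}"
proof (rule finite_subset)
  show "{b::nat. 2 ^ b \<le> m} \<subseteq> {..m}"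
    using less_exp le_trans less_imp_le by (metis (mono_tags, lifting) atMost_iff mem_Collect_eq subsetI)
qed simp

text \<open>Abel summation: truncated subtraction makes \<open>l - s\<close> the hinge of width
  \<open>l\<close>, and it counts the \<open>j\<close> in \<open>{1..l}\<close> with
  \<open>s < j\<close>.\<close>

lemma sum_hinge_eq_sum_partial_sums:
  fixes e :: "nat \<Rightarrow> real"
  assumes "l \<le> m"
  shows "(\<Sum>s<m. e s * real (l - s)) = (\<Sum>j=1..l. \<Sum>s<j. e s)"
  using assms
proof (induction l)
  case (Suc l)
  have "(\<Sum>s<m. e s * real (Suc l - s)) = (\<Sum>s<m. e s * real (l - s) + (if s < Suc l then e s else 0))"
    by (rule sum.cong) (auto simp: Suc_diff_le algebra_simps not_less)
  also have "\<dots> = (\<Sum>s<m. e s * real (l - s)) + (\<Sum>s<m. if s < Suc l then e s else 0)"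
    by (rule sum.distrib)
  also have "(\<Sum>s<m. if s < Suc l then e s else 0) = (\<Sum>s<Suc l. e s)"
    using Suc.prems by (intro sum.mono_neutral_cong_right) auto
  finally show ?case using Suc by simp
qed simp

lemma sum_hinge_squares_ge: "real l ^ 3 / 3 \<le> (\<Sum>s<l. (real (l - s))\<^sup>2)"
proof (induction l)
  case (Suc l)
  have "(\<Sum>s<Suc l. (real (Suc l - s))\<^sup>2) = (real (Suc l))\<^sup>2 + (\<Sum>s<l. (real (l - s))\<^sup>2)"
    by (subst sum.lessThan_Suc_shift) simp
  moreover have "real (Suc l) ^ 3 / 3 \<le> (real (Suc l))\<^sup>2 + real l ^ 3 / 3"
    by (simp add: power2_eq_square power3_eq_cube algebra_simps)
  ultimately show ?case using Suc by linarith
qed simp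

lemma sum_squares_le_square_sum:
  fixes f :: "'a \<Rightarrow> real"
  assumes "finite A" "\<And>x. x \<in> A \<Longrightarrow> 0 \<le> f x"
  shows "(\<Sum>x\<in>A. (f x)\<^sup>2) \<le> (\<Sum>x\<in>A. f x)\<^sup>2"
  using assms
proof (induction A rule: finite_induct)
  case (insert x A)
  have "0 \<le> f x * sum f A" using insert by (intro mult_nonneg_nonneg sum_nonneg) auto
  then have "(f x)\<^sup>2 + (sum f A)\<^sup>2 \<le> (f x + sum f A)\<^sup>2" by (simp add: power2_sum)
  moreover have "(\<Sum>y\<in>A. (f y)\<^sup>2) \<le> (sum f A)\<^sup>2" using insert by auto
  ultimately show ?case using insert(1,2) by simp
qed simp

lemma excess_nonneg: "0 \<le> excess t m e"
  unfolding excess_def by (intro sum_nonneg mult_nonneg_nonneg) auto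

text \<open>This bounds U_b; the divisor is the lower bound of \<open>sum_hinge_squares_ge\<close>
  for the squared norm of the hinge of width \<open>2 ^ b\<close>. Cauchy-Schwarz over at most 2 *
  2^b partial sums, together with W_j^2 = j * (W_j^2 / j) and j <= 2 * 2^b, gives the factors 24 = 2
  * 2 * 2 * 3 and 12 = 2 * 2 * 3.\<close>

lemma dyadic_block_bound:
  fixes e :: "nat \<Rightarrow> real" and b m :: nat and t :: real
  defines "J \<equiv> {1..min m (2 ^ Suc b)}"
  assumes t: "0 \<le> t"
  shows "(\<Sum>j\<in>J. \<bar>\<Sum>s<j. e s\<bar>)\<^sup>2 / ((2 ^ b) ^ 3 / 3) \<le>
    24 * t + 12 / 2 ^ b * (\<Sum>j\<in>J. max 0 ((\<Sum>s<j. e s)\<^sup>2 / real j - t))" (is "?V\<^sup>2 / _ \<le> _ + _ * ?X")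
proof -
  let ?B = "2 ^ b :: real"
  have cJ: "real (card J) \<le> 2 * ?B"
  proof -
    have "card J \<le> 2 ^ Suc b" by (simp add: J_def)
    then have "real (card J) \<le> real (2 ^ Suc b)" by (rule of_nat_mono)
    then show ?thesis by simp
  qed
  have "(\<Sum>s<j. e s)\<^sup>2 \<le> 2 * ?B * (t + max 0 ((\<Sum>s<j. e s)\<^sup>2 / real j - t))" if "j \<in> J" for j
  proof -
    have j: "0 < j" "j \<le> 2 ^ Suc b" using that by (auto simp: J_def)
    have "real j \<le> real (2 ^ Suc b)" using j(2) by (rule of_nat_mono)
    then have j2: "real j \<le> 2 * ?B" by simp
    have "(\<Sum>s<j. e s)\<^sup>2 = real j * ((\<Sum>s<j. e s)\<^sup>2 / real j)" using j by simp
    also have "\<dots> \<le> real j * (t + max 0 ((\<Sum>s<j. e s)\<^sup>2 / real j - t))"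
      by (rule mult_left_mono) auto
    also have "\<dots> \<le> 2 * ?B * (t + max 0 ((\<Sum>s<j. e s)\<^sup>2 / real j - t))"
      by (rule mult_right_mono[OF j2]) (use t in auto)
    finally show ?thesis .
  qed
  then have "(\<Sum>j\<in>J. (\<Sum>s<j. e s)\<^sup>2) \<le> (\<Sum>j\<in>J. 2 * ?B * (t + max 0 ((\<Sum>s<j. e s)\<^sup>2 / real j - t)))"
    by (rule sum_mono)
  also have "\<dots> = 2 * ?B * (real (card J) * t + ?X)"
    by (simp add: sum.distrib sum_distrib_left algebra_simps)
  also have "\<dots> \<le> 2 * ?B * (2 * ?B * t + ?X)"
    using cJ t by (intro mult_left_mono add_right_mono mult_right_mono) auto
  finally have W: "(\<Sum>j\<in>J. (\<Sum>s<j. e s)\<^sup>2) \<le> 2 * ?B * (2 * ?B * t + ?X)" .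
  have "?V\<^sup>2 \<le> (\<Sum>j\<in>J. (\<Sum>s<j. e s)\<^sup>2) * card J"
    using sum_squared_le_sum_of_squares[of "\<lambda>j. \<bar>\<Sum>s<j. e s\<bar>" J] by simp
  also have "\<dots> \<le> 2 * ?B * (2 * ?B * t + ?X) * (2 * ?B)"
    using W cJ t by (intro mult_mono mult_nonneg_nonneg add_nonneg_nonneg sum_nonneg) auto
  finally have "?V\<^sup>2 / (?B ^ 3 / 3) \<le> 2 * ?B * (2 * ?B * t + ?X) * (2 * ?B) / (?B ^ 3 / 3)"
    by (rule divide_right_mono) simp
  also have "\<dots> = 24 * t + 12 / ?B * ?X"
    by (simp add: field_simps power3_eq_cube)
  finally show ?thesis .
qed

text \<open>Widths are grouped by \<open>floor_log\<close>. A width \<open>l\<close> in group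
  \<open>b\<close> has 2^b <= l < 2^(b+1): the lower bound gives w >= \<Sum> A_b (2^b - s)_+
  pointwise, whose square dominates the sum of the squares because all terms are nonnegative; the
  upper bound gives |\<Sum>_(j <= l) W_j| <= V_b. A Cauchy-Schwarz inequality over the scales,
  weighted by \<open>c b\<close>, joins the two.\<close>

lemma hinge_bound:
  fixes e a :: "nat \<Rightarrow> real" and K :: "nat set" and t :: real
  defines "w \<equiv> \<lambda>s. \<Sum>l\<in>K. a l * real (l - s)"
  assumes a: "\<And>l. l \<in> K \<Longrightarrow> 0 \<le> a l" and K: "K \<subseteq> {1..m}" and t: "0 \<le> t"
  shows "(\<Sum>s<m. e s * w s)\<^sup>2 \<le> (\<Sum>s<m. (w s)\<^sup>2) * (24 * t * card K + excess t m e)"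
proof -
  have finK: "finite K" using K finite_subset by blast
  define B where "B = floor_log ` K"
  define A where "A b = (\<Sum>l\<in>{l\<in>K. floor_log l = b}. a l)" for b
  define c where "c b = (2 ^ b) ^ 3 / (3::real)" for b :: nat
  define J where "J b = {1..min m (2 ^ Suc b)}" for b :: nat
  define V where "V b = (\<Sum>j\<in>J b. \<bar>\<Sum>s<j. e s\<bar>)" for b
  have finB: "finite B" using finK by (simp add: B_def)
  have cpos: "0 < c b" for b by (simp add: c_def)
  have A0: "0 \<le> A b" for b unfolding A_def using a by (intro sum_nonneg) auto
  have group: "(\<Sum>l\<in>K. a l * g l) = (\<Sum>b\<in>B. \<Sum>l\<in>{l\<in>K. floor_log l = b}. a l * g l)" for g
    unfolding B_def by (rule sum.image_gen[OF finK])
  have low: "2 ^ floor_log l \<le> l" and high: "l < 2 ^ Suc (floor_log l)" if "l \<in> K" for l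
    using that K floor_log_exp2_le[of l] floor_log_exp2_gt[of l] by auto
  have low_m: "2 ^ floor_log l \<le> m" if "l \<in> K" for l
    using low[OF that] that K by (meson atLeastAtMost_iff order_trans subsetD)
  have w_ge: "(\<Sum>b\<in>B. (A b)\<^sup>2 * (real (2 ^ b - s))\<^sup>2) \<le> (w s)\<^sup>2" for s
  proof -
    have "(\<Sum>b\<in>B. A b * real (2 ^ b - s)) \<le> w s"
      unfolding w_def group A_def sum_distrib_right
      using a low by (intro sum_mono mult_left_mono) (auto intro: diff_le_mono)
    moreover have "0 \<le> (\<Sum>b\<in>B. A b * real (2 ^ b - s))"
      using A0 by (intro sum_nonneg) auto
    ultimately have "(\<Sum>b\<in>B. A b * real (2 ^ b - s))\<^sup>2 \<le> (w s)\<^sup>2"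
      by (rule power_mono)
    moreover have "(\<Sum>b\<in>B. (A b * real (2 ^ b - s))\<^sup>2) \<le> (\<Sum>b\<in>B. A b * real (2 ^ b - s))\<^sup>2"
      using A0 finB by (intro sum_squares_le_square_sum) auto
    ultimately show ?thesis by (simp add: power_mult_distrib)
  qed
  have norm: "(\<Sum>b\<in>B. (A b)\<^sup>2 * c b) \<le> (\<Sum>s<m. (w s)\<^sup>2)"
  proof -
    have "(\<Sum>b\<in>B. (A b)\<^sup>2 * c b) \<le> (\<Sum>b\<in>B. (A b)\<^sup>2 * (\<Sum>s<m. (real (2 ^ b - s))\<^sup>2))"
    proof (intro sum_mono mult_left_mono)
      fix b assume "b \<in> B"
      then have "2 ^ b \<le> m" using low_m by (auto simp: B_def)
      then have "(\<Sum>s<2 ^ b. (real (2 ^ b - s))\<^sup>2) \<le> (\<Sum>s<m. (real (2 ^ b - s))\<^sup>2)"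
        by (intro sum_mono2) auto
      then show "c b \<le> (\<Sum>s<m. (real (2 ^ b - s))\<^sup>2)"
        using sum_hinge_squares_ge[of "2 ^ b"] by (simp add: c_def)
    qed simp
    also have "\<dots> = (\<Sum>s<m. \<Sum>b\<in>B. (A b)\<^sup>2 * (real (2 ^ b - s))\<^sup>2)"
      unfolding sum_distrib_left by (rule sum.swap)
    also have "\<dots> \<le> (\<Sum>s<m. (w s)\<^sup>2)" by (intro sum_mono w_ge)
    finally show ?thesis .
  qed
  have "(\<Sum>s<m. e s * w s) = (\<Sum>l\<in>K. a l * (\<Sum>s<m. e s * real (l - s)))"
    unfolding w_def sum_distrib_left by (subst sum.swap) (simp add: ac_simps)
  also have "\<dots> = (\<Sum>l\<in>K. a l * (\<Sum>j=1..l. \<Sum>s<j. e s))"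
    using K by (intro sum.cong refl) (subst sum_hinge_eq_sum_partial_sums, auto)
  finally have "\<bar>\<Sum>s<m. e s * w s\<bar> = \<bar>\<Sum>l\<in>K. a l * (\<Sum>j=1..l. \<Sum>s<j. e s)\<bar>" by simp
  also have "\<dots> \<le> (\<Sum>l\<in>K. \<bar>a l * (\<Sum>j=1..l. \<Sum>s<j. e s)\<bar>)" by (rule sum_abs)
  also have "\<dots> \<le> (\<Sum>l\<in>K. a l * (\<Sum>j=1..l. \<bar>\<Sum>s<j. e s\<bar>))"
    using a by (intro sum_mono) (auto simp: abs_mult intro!: mult_left_mono)
  also have "\<dots> \<le> (\<Sum>b\<in>B. A b * V b)"
    unfolding group A_def sum_distrib_right
  proof (intro sum_mono mult_left_mono)
    fix b l assume l: "l \<in> {l \<in> K. floor_log l = b}"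
    then have "{1..l} \<subseteq> J b" using high[of l] K by (auto simp: J_def)
    then show "(\<Sum>j=1..l. \<bar>\<Sum>s<j. e s\<bar>) \<le> V b"
      unfolding V_def by (intro sum_mono2) (auto simp: J_def)
  qed (use a in auto)
  finally have "\<bar>\<Sum>s<m. e s * w s\<bar> \<le> (\<Sum>b\<in>B. A b * V b)" .
  then have "(\<Sum>s<m. e s * w s)\<^sup>2 \<le> (\<Sum>b\<in>B. A b * V b)\<^sup>2"
    using power_mono[of "\<bar>\<Sum>s<m. e s * w s\<bar>" _ 2] by simp
  also have "\<dots> = (\<Sum>b\<in>B. (A b * sqrt (c b)) * (V b / sqrt (c b)))\<^sup>2"
    using cpos by (intro arg_cong[where f = "\<lambda>x. x\<^sup>2"] sum.cong refl) (simp add: less_imp_neq[THEN not_sym])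
  also have "\<dots> \<le> (\<Sum>b\<in>B. (A b * sqrt (c b))\<^sup>2) * (\<Sum>b\<in>B. (V b / sqrt (c b))\<^sup>2)"
    by (rule Cauchy_Schwarz_ineq_sum)
  also have "\<dots> = (\<Sum>b\<in>B. (A b)\<^sup>2 * c b) * (\<Sum>b\<in>B. (V b)\<^sup>2 / c b)"
    using cpos by (simp add: power_mult_distrib power_divide less_imp_le)
  also have "\<dots> \<le> (\<Sum>s<m. (w s)\<^sup>2) * (24 * t * card K + excess t m e)"
  proof (rule mult_mono[OF norm])
    let ?X = "\<lambda>b. 12 / 2 ^ b * (\<Sum>j\<in>J b. max 0 ((\<Sum>s<j. e s)\<^sup>2 / real j - t))"
    have "(\<Sum>b\<in>B. (V b)\<^sup>2 / c b) \<le> (\<Sum>b\<in>B. 24 * t + ?X b)"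
      unfolding V_def c_def J_def using t by (intro sum_mono dyadic_block_bound)
    also have "\<dots> = 24 * t * card B + (\<Sum>b\<in>B. ?X b)"
      by (simp add: sum.distrib)
    \<comment> \<open>The level \<open>24 * t\<close> is paid once per occupied scale, hence at most
      \<open>card K\<close> times. The excesses are extended to all scales, so that beyond its
      cardinality nothing of the noise-dependent set \<open>K\<close> remains.\<close>
    also have "\<dots> \<le> 24 * t * card K + excess t m e"
    proof (rule add_mono)
      show "24 * t * card B \<le> 24 * t * card K"
        using t card_image_le[OF finK, of floor_log] by (intro mult_left_mono) (auto simp: B_def)
      have "B \<subseteq> {b. 2 ^ b \<le> m}" using low_m by (auto simp: B_def)
      then show "(\<Sum>b\<in>B. ?X b) \<le> excess t m e"
        unfolding excess_def J_def
        by (intro sum_mono2 finite_dyadic_scales mult_nonneg_nonneg sum_nonneg) auto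
    qed
    finally show "(\<Sum>b\<in>B. (V b)\<^sup>2 / c b) \<le> 24 * t * card K + excess t m e" .
  qed (use cpos in \<open>auto intro!: sum_nonneg divide_nonneg_nonneg simp: less_imp_le\<close>)
  finally show ?thesis .
qed

subsection \<open>Convex sequences\<close>

lemma sum_reverse_index:
  fixes g :: "nat \<Rightarrow> real"
  shows "(\<Sum>x=1..m. g x) = (\<Sum>s<m. g (m - s))"
  by (rule sum.reindex_bij_witness[where i = "\<lambda>s. m - s" and j = "\<lambda>x. m - x"]) auto

text \<open>Discrete Taylor formula with hinges as remainder. The range of \<open>t\<close> ends at
  a fixed \<open>M\<close> rather than at \<open>y\<close>, so that one family of hinges serves all
  \<open>y\<close>.\<close>

lemma second_difference_expansion:
  fixes f :: "nat \<Rightarrow> real"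
  assumes "y \<le> M"
  shows "f y = f 0 + real y * (f 1 - f 0) +
    (\<Sum>t=1..<M. (f (t + 1) - 2 * f t + f (t - 1)) * real (y - t))"
  using assms
proof (induction y)
  case (Suc y)
  let ?D = "\<lambda>t. f (t + 1) - 2 * f t + f (t - 1)"
  have slope: "f (Suc y) - f y = f 1 - f 0 + (\<Sum>t=1..y. ?D t)" for y
    by (induction y) auto
  have "(\<Sum>t=1..<M. ?D t * real (Suc y - t)) = (\<Sum>t=1..<M. ?D t * real (y - t) + (if t \<le> y then ?D t else 0))"
    by (rule sum.cong) (auto simp: Suc_diff_le algebra_simps)
  also have "\<dots> = (\<Sum>t=1..<M. ?D t * real (y - t)) + (\<Sum>t=1..<M. if t \<le> y then ?D t else 0)"
    by (rule sum.distrib)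
  also have "(\<Sum>t=1..<M. if t \<le> y then ?D t else 0) = (\<Sum>t=1..y. ?D t)"
    using Suc.prems by (intro sum.mono_neutral_cong_right) auto
  finally have "(\<Sum>t=1..<M. ?D t * real (Suc y - t)) =
      (\<Sum>t=1..<M. ?D t * real (y - t)) + (\<Sum>t=1..y. ?D t)" .
  then show ?case using Suc.IH Suc.prems slope[of y] by (simp add: algebra_simps)
qed simp

text \<open>One summand for each way the noise can enter: the mean of the
  \<open>(e x)\<^sup>2\<close> for pieces too short to be expanded, the mean of the W_j^2 / j for
  the slope of the line, W_m^2 / m for its constant, and two excesses for the hinges anchored at the
  right end (\<open>e (m - s)\<close>, read backwards) and at the left end
  (\<open>e (Suc s)\<close>).\<close>

definition noise_level :: "real \<Rightarrow> nat \<Rightarrow> (nat \<Rightarrow> real) \<Rightarrow> real" where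
  "noise_level t m e =
     ((\<Sum>x=1..m. (e x)\<^sup>2) + (\<Sum>j=1..m. (\<Sum>s<j. e (m - s))\<^sup>2 / real j)) / real m +
     (\<Sum>s<m. e (m - s))\<^sup>2 / real m +
     excess t m (\<lambda>s. e (m - s)) + excess t m (\<lambda>s. e (Suc s))"

lemma square_sum3_le: "((a::real) + b + c)\<^sup>2 \<le> 3 * (a\<^sup>2 + b\<^sup>2 + c\<^sup>2)"
  using zero_le_power2[of "a - b"] zero_le_power2[of "a - c"] zero_le_power2[of "b - c"]
  by (simp add: power2_eq_square algebra_simps)

lemma sum_subfamily_squares_le:
  fixes v :: "nat \<Rightarrow> real"
  assumes "inj_on g A" "g ` A \<subseteq> {1..m}"
  shows "(\<Sum>x\<in>A. (v (g x))\<^sup>2) \<le> (\<Sum>x=1..m. (v x)\<^sup>2)"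
proof -
  have "(\<Sum>x\<in>A. (v (g x))\<^sup>2) = (\<Sum>x\<in>g ` A. (v x)\<^sup>2)"
    using assms(1) by (simp add: sum.reindex)
  also have "\<dots> \<le> (\<Sum>x=1..m. (v x)\<^sup>2)" using assms(2) by (intro sum_mono2) auto
  finally show ?thesis .
qed

text \<open>Two Taylor expansions back to back. The leftward one starts at \<open>c + 1\<close>
  instead of \<open>c\<close>: both then share the slope \<open>\<beta>\<close>, and the second
  difference at \<open>c\<close> falls to \<open>L\<close>.\<close>

lemma convex_sequence_decomposition:
  fixes v :: "nat \<Rightarrow> real" and m :: nat
  defines "h \<equiv> m div 4"
  defines "c \<equiv> h + 1"
  defines "d \<equiv> \<lambda>x. v (x + 1) - 2 * v x + v (x - 1)"
  defines "\<beta> \<equiv> v (c + 1) - v c"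
  defines "R \<equiv> \<lambda>x. \<Sum>t\<in>{c<..<m}. d t * real (x - t)"
  defines "L \<equiv> \<lambda>x. \<Sum>t\<in>{1<..c}. d t * real (t - x)"
  assumes x: "1 \<le> x" "x \<le> m" and m: "4 \<le> m"
  shows "v x = v c + \<beta> * (real x - real c) + R x + L x"
proof (cases "c \<le> x")
  case True
  define f where "f y = v (c + y)" for y
  have "(\<Sum>t=1..<m-c. (f (t + 1) - 2 * f t + f (t - 1)) * real (x - c - t)) = R x"
    unfolding R_def
    by (rule sum.reindex_bij_witness[where i = "\<lambda>t. t - c" and j = "\<lambda>t. c + t"])
      (auto simp: f_def d_def)
  moreover have "L x = 0" using True by (auto simp: L_def intro!: sum.neutral)
  ultimately show ?thesis
    using second_difference_expansion[of "x - c" "m - c" f] True x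
    by (simp add: f_def \<beta>_def algebra_simps)
next
  case False
  define f where "f y = v (c + 1 - y)" for y
  have "(\<Sum>t=1..<c. (f (t + 1) - 2 * f t + f (t - 1)) * real (c + 1 - x - t)) = L x"
    unfolding L_def
    by (rule sum.reindex_bij_witness[where i = "\<lambda>t. c + 1 - t" and j = "\<lambda>t. c + 1 - t"])
      (auto simp: f_def d_def Suc_diff_Suc Suc_diff_le add.commute)
  moreover have "R x = 0" using False by (auto simp: R_def intro!: sum.neutral)
  moreover have "real (c + 1 - x) = real c + 1 - real x" using False by simp
  moreover have "c + 1 - (c + 1 - x) = x" using False by simp
  ultimately show ?thesis
    using second_difference_expansion[of "c + 1 - x" c f] False x
    by (simp add: f_def \<beta>_def algebra_simps)
qed

text \<open>
  Averages over \<open>y\<close> the convexity estimates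
  \<open>2 v(c + y) - v(c + 2y) \<le> v(c) \<le> (v(c + y) + v(c - y))/2\<close> and
  \<open>v(c) - v(c - y) \<le> \<beta> y \<le> v(c + y) - v(c)\<close>; they need room on both sides of \<open>c\<close>.
\<close>

lemma support_line_bound:
  fixes v :: "nat \<Rightarrow> real" and m :: nat
  defines "h \<equiv> m div 4"
  defines "c \<equiv> h + 1"
  defines "\<beta> \<equiv> v (c + 1) - v c"
  defines "S \<equiv> \<Sum>x=1..m. (v x)\<^sup>2"
  assumes m: "4 \<le> m"
    and conv: "\<And>x. 1 < x \<Longrightarrow> x < m \<Longrightarrow> 0 \<le> v (x + 1) - 2 * v x + v (x - 1)"
  shows "(v c - \<beta> * real c)\<^sup>2 * real m \<le> 240000 * S" and "\<beta>\<^sup>2 * real m ^ 3 \<le> 120000 * S"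
proof -
  define d where "d x = v (x + 1) - 2 * v x + v (x - 1)" for x
  define R where "R x = (\<Sum>t\<in>{c<..<m}. d t * real (x - t))" for x
  define L where "L x = (\<Sum>t\<in>{1<..c}. d t * real (t - x))" for x
  \<comment> \<open>The choice \<open>m div 4\<close> leaves room for \<open>h\<close> points to the
    left of \<open>c\<close> and \<open>2 * h\<close> to the right. The factor 7 is attained at
    \<open>m = 7\<close>, \<open>h = 1\<close>.\<close>
  have h: "1 \<le> h" "c + 2 * h \<le> m" "m \<le> 7 * h" "c < m"
    using m unfolding h_def c_def by presburger+
  have d0: "0 \<le> d x" if "1 < x" "x < m" for x using conv that by (simp add: d_def)
  have dec: "v x = v c + \<beta> * (real x - real c) + R x + L x" if "1 \<le> x" "x \<le> m" for x
    unfolding \<beta>_def R_def L_def d_def c_def h_def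
    using that m by (rule convex_sequence_decomposition)
  have R0: "0 \<le> R x" and L0: "0 \<le> L x" for x
    using d0 h by (auto simp: R_def L_def c_def intro!: sum_nonneg mult_nonneg_nonneg)
  have Lr: "L (c + y) = 0" for y by (auto simp: L_def intro!: sum.neutral)
  have Rl: "R (c - y) = 0" for y by (auto simp: R_def intro!: sum.neutral)
  have right: "v (c + y) = v c + \<beta> * real y + R (c + y)" if "y \<le> 2 * h" for y
    using dec[of "c + y"] Lr[of y] that h by (simp add: c_def)
  have left: "v (c - y) = v c - \<beta> * real y + L (c - y)" if "y \<le> h" for y
    using dec[of "c - y"] Rl[of y] that h by (simp add: c_def)
  \<comment> \<open>\<open>R\<close> is convex to the right of \<open>c\<close> and vanishes at
    \<open>c\<close>, so doubling the distance at least doubles it. The remainder thus cancels with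
    a favourable sign in 2 v(c + y) - v(c + 2y), which bounds \<open>v c\<close> from below.\<close>
  have R2: "2 * R (c + y) \<le> R (c + 2 * y)" for y
    unfolding R_def sum_distrib_left
  proof (intro sum_mono)
    fix t assume t: "t \<in> {c<..<m}"
    have "2 * real (c + y - t) \<le> real (c + 2 * y - t)" using t by auto
    then show "2 * (d t * real (c + y - t)) \<le> d t * real (c + 2 * y - t)"
      using mult_left_mono[OF _ d0[of t]] t by (fastforce simp: c_def)
  qed
  define p where "p y = v (c + y)" for y
  define q where "q y = v (c + 2 * y)" for y
  define r where "r y = v (c - y)" for y
  have sums: "(\<Sum>y=1..h. (p y)\<^sup>2) \<le> S" "(\<Sum>y=1..h. (q y)\<^sup>2) \<le> S" "(\<Sum>y=1..h. (r y)\<^sup>2) \<le> S"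
    unfolding S_def p_def q_def r_def using h
    by (rule_tac sum_subfamily_squares_le; force simp: c_def inj_on_def)+
  have S0: "0 \<le> S" by (auto simp: S_def intro: sum_nonneg)
  have vc: "(v c)\<^sup>2 \<le> 12 * ((p y)\<^sup>2 + (q y)\<^sup>2 + (r y)\<^sup>2)" if "y \<in> {1..h}" for y
  proof -
    have "2 * p y - q y \<le> v c" "2 * v c \<le> p y + r y"
      using right[of y] right[of "2 * y"] left[of y] R2[of y] R0[of "c + y"] L0[of "c - y"] that
      by (auto simp: p_def q_def r_def)
    then have "\<bar>v c\<bar> \<le> \<bar>2 * \<bar>p y\<bar> + \<bar>q y\<bar> + \<bar>r y\<bar>\<bar>" by linarith
    then have "(v c)\<^sup>2 \<le> (2 * \<bar>p y\<bar> + \<bar>q y\<bar> + \<bar>r y\<bar>)\<^sup>2" by (simp only: abs_le_square_iff)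
    also have "\<dots> \<le> 3 * ((2 * \<bar>p y\<bar>)\<^sup>2 + \<bar>q y\<bar>\<^sup>2 + \<bar>r y\<bar>\<^sup>2)" by (rule square_sum3_le)
    also have "\<dots> \<le> 12 * ((p y)\<^sup>2 + (q y)\<^sup>2 + (r y)\<^sup>2)" by simp
    finally show ?thesis .
  qed
  have "real h * (v c)\<^sup>2 = (\<Sum>y=1..h. (v c)\<^sup>2)" by simp
  also have "\<dots> \<le> (\<Sum>y=1..h. 12 * ((p y)\<^sup>2 + (q y)\<^sup>2 + (r y)\<^sup>2))" by (intro sum_mono vc)
  also have "\<dots> \<le> 36 * S"
    using sums by (simp add: sum_distrib_left[symmetric] sum.distrib)
  finally have hvc: "real h * (v c)\<^sup>2 \<le> 36 * S" .
  have \<beta>: "\<beta>\<^sup>2 * (real y)\<^sup>2 \<le> 3 * ((p y)\<^sup>2 + (r y)\<^sup>2 + (v c)\<^sup>2)" if "y \<in> {1..h}" for y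
  proof -
    have "\<beta> * real y \<le> p y - v c" "v c - r y \<le> \<beta> * real y"
      using right[of y] left[of y] R0[of "c + y"] L0[of "c - y"] that by (auto simp: p_def r_def)
    then have "\<bar>\<beta> * real y\<bar> \<le> \<bar>\<bar>p y\<bar> + \<bar>r y\<bar> + \<bar>v c\<bar>\<bar>" by linarith
    then have "(\<beta> * real y)\<^sup>2 \<le> (\<bar>p y\<bar> + \<bar>r y\<bar> + \<bar>v c\<bar>)\<^sup>2" by (simp only: abs_le_square_iff)
    also have "\<dots> \<le> 3 * (\<bar>p y\<bar>\<^sup>2 + \<bar>r y\<bar>\<^sup>2 + \<bar>v c\<bar>\<^sup>2)" by (rule square_sum3_le)
    finally show ?thesis by (simp add: power_mult_distrib)
  qed
  have "real h ^ 3 / 3 \<le> (\<Sum>s<h. (real (h - s))\<^sup>2)" by (rule sum_hinge_squares_ge)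
  also have "\<dots> = (\<Sum>y=1..h. (real y)\<^sup>2)" by (rule sum_reverse_index[symmetric])
  finally have "\<beta>\<^sup>2 * (real h ^ 3 / 3) \<le> \<beta>\<^sup>2 * (\<Sum>y=1..h. (real y)\<^sup>2)" by (rule mult_left_mono) simp
  also have "\<dots> \<le> (\<Sum>y=1..h. 3 * ((p y)\<^sup>2 + (r y)\<^sup>2 + (v c)\<^sup>2))"
    unfolding sum_distrib_left by (intro sum_mono \<beta>)
  also have "\<dots> \<le> 114 * S"
    using sums hvc by (simp add: sum_distrib_left[symmetric] sum.distrib)
  finally have h\<beta>: "\<beta>\<^sup>2 * real h ^ 3 \<le> 342 * S" by simp
  \<comment> \<open>Passing from \<open>h\<close> to \<open>m\<close> costs 7 * 36 = 252 for
    \<open>v c\<close> and 7^3 * 342 = 117306 for the slope; the constants in the conclusion are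
    rounded up from these.\<close>
  have mh: "real m \<le> 7 * real h" using h(3) by (metis of_nat_mono of_nat_mult of_nat_numeral)
  have mvc: "real m * (v c)\<^sup>2 \<le> 252 * S"
    using mult_right_mono[OF mh, of "(v c)\<^sup>2"] hvc by simp
  have "\<beta>\<^sup>2 * real m ^ 3 \<le> \<beta>\<^sup>2 * (7 * real h) ^ 3"
    using mh by (intro mult_left_mono power_mono) auto
  also have "\<dots> \<le> 117306 * S" using h\<beta> by (simp add: power_mult_distrib)
  finally have m\<beta>: "\<beta>\<^sup>2 * real m ^ 3 \<le> 117306 * S" .
  then show "\<beta>\<^sup>2 * real m ^ 3 \<le> 120000 * S" using S0 by linarith
  have "(v c - \<beta> * real c)\<^sup>2 \<le> 2 * (v c)\<^sup>2 + 2 * (\<beta> * real c)\<^sup>2"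
    using zero_le_power2[of "v c + \<beta> * real c"] by (simp add: power2_eq_square algebra_simps)
  also have "\<dots> \<le> 2 * (v c)\<^sup>2 + 2 * (\<beta>\<^sup>2 * (real m)\<^sup>2)"
    unfolding power_mult_distrib using h(4) by (intro add_left_mono mult_left_mono power_mono) auto
  finally have "(v c - \<beta> * real c)\<^sup>2 * real m \<le> (2 * (v c)\<^sup>2 + 2 * (\<beta>\<^sup>2 * (real m)\<^sup>2)) * real m"
    by (rule mult_right_mono) simp
  also have "\<dots> = 2 * (real m * (v c)\<^sup>2) + 2 * (\<beta>\<^sup>2 * real m ^ 3)"
    by (simp add: power2_eq_square power3_eq_cube algebra_simps)
  also have "\<dots> \<le> 240000 * S" using mvc m\<beta> S0 by linarith
  finally show "(v c - \<beta> * real c)\<^sup>2 * real m \<le> 240000 * S" .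
qed

section \<open>Correlation of the noise with one convex sequence\<close>

lemma sum_squares_le_3_mean:
  fixes e :: "nat \<Rightarrow> real"
  assumes "m \<le> 3"
  shows "(\<Sum>x=1..m. (e x)\<^sup>2) \<le> 3 * ((\<Sum>x=1..m. (e x)\<^sup>2) / real m)"
proof (cases "m = 0")
  case False
  have "(\<Sum>x=1..m. (e x)\<^sup>2) * real m \<le> (\<Sum>x=1..m. (e x)\<^sup>2) * 3"
    using assms by (intro mult_left_mono sum_nonneg) auto
  then show ?thesis using False by (simp add: field_simps)
qed simp

lemma square_sum4_le: "((a::real) + b + c + d)\<^sup>2 \<le> 4 * (a\<^sup>2 + b\<^sup>2 + c\<^sup>2 + d\<^sup>2)"
  using zero_le_power2[of "a - b"] zero_le_power2[of "a - c"] zero_le_power2[of "a - d"]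
    zero_le_power2[of "b - c"] zero_le_power2[of "b - d"] zero_le_power2[of "c - d"]
  by (simp add: power2_eq_square algebra_simps)

text \<open>The noise is paired separately with the constant, the slope, \<open>R\<close> and
  \<open>L\<close>. Each squared pairing is at most the squared norm of \<open>v\<close> times a
  summand of \<open>noise_level\<close>, plus a multiple of \<open>t * card K\<close> for the hinge
  parts. The norms of \<open>R\<close> and \<open>L\<close> are controlled because both are
  nonnegative and sum to \<open>v\<close> minus its support line.\<close>

lemma convex_sequence_bound:
  fixes v e :: "nat \<Rightarrow> real" and m :: nat and t :: real
  defines "K \<equiv> {x. 1 < x \<and> x < m \<and> v (x + 1) - 2 * v x + v (x - 1) \<noteq> 0}"
  assumes conv: "\<And>x. 1 < x \<Longrightarrow> x < m \<Longrightarrow> 0 \<le> v (x + 1) - 2 * v x + v (x - 1)"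
    and t: "0 \<le> t"
  shows "(\<Sum>x=1..m. e x * v x)\<^sup>2 \<le>
    300000000 * (\<Sum>x=1..m. (v x)\<^sup>2) * (t * card K + noise_level t m e)"
proof -
  define S where "S = (\<Sum>x=1..m. (v x)\<^sup>2)"
  define E where "E = (\<Sum>x=1..m. (e x)\<^sup>2) / real m"
  define W where "W j = (\<Sum>s<j. e (m - s))" for j
  define Q where "Q = (\<Sum>j=1..m. (W j)\<^sup>2 / real j) / real m"
  define XR where "XR = excess t m (\<lambda>s. e (m - s))"
  define XL where "XL = excess t m (\<lambda>s. e (Suc s))"
  have level: "noise_level t m e = E + Q + (W m)\<^sup>2 / real m + XR + XL"
    by (simp add: noise_level_def E_def Q_def W_def XR_def XL_def add_divide_distrib)
  have nn: "0 \<le> S" "0 \<le> E" "0 \<le> Q" "0 \<le> (W m)\<^sup>2 / real m" "0 \<le> XR" "0 \<le> XL" "0 \<le> t * card K"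
    using t by (auto simp: S_def E_def Q_def XR_def XL_def intro!: sum_nonneg divide_nonneg_nonneg excess_nonneg)
  show ?thesis
  proof (cases "m \<le> 3")
    \<comment> \<open>A piece this short has no room on both sides of \<open>c\<close>; plain
      Cauchy-Schwarz loses only the factor 3.\<close>
    case True
    have "(\<Sum>x=1..m. e x * v x)\<^sup>2 \<le> (\<Sum>x=1..m. (e x)\<^sup>2) * S"
      unfolding S_def by (rule Cauchy_Schwarz_ineq_sum)
    also have "\<dots> \<le> (3 * E) * S"
      unfolding E_def using sum_squares_le_3_mean[OF True] nn(1) by (intro mult_right_mono) auto
    also have "\<dots> \<le> (300000000 * (t * card K + noise_level t m e)) * S"
      using nn by (intro mult_right_mono) (auto simp: level)
    finally show ?thesis by (simp only: S_def mult_ac)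
  next
    case False
    then have m: "4 \<le> m" by simp
    define c where "c = m div 4 + 1"
    define d where "d x = v (x + 1) - 2 * v x + v (x - 1)" for x
    define \<beta> where "\<beta> = v (c + 1) - v c"
    define \<gamma> where "\<gamma> = v c - \<beta> * real c"
    define R where "R x = (\<Sum>t\<in>{c<..<m}. d t * real (x - t))" for x
    define L where "L x = (\<Sum>t\<in>{1<..c}. d t * real (t - x))" for x
    have cm: "2 \<le> c" "c < m" using m unfolding c_def by presburger+
    have \<gamma>S: "\<gamma>\<^sup>2 * real m \<le> 240000 * S" and \<beta>S: "\<beta>\<^sup>2 * real m ^ 3 \<le> 120000 * S"
      unfolding \<gamma>_def \<beta>_def c_def S_def using support_line_bound[of m v, OF m conv] by auto
    have d0: "0 \<le> d x" if "1 < x" "x < m" for x using conv that by (simp add: d_def)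
    have dec: "v x = \<gamma> + \<beta> * real x + R x + L x" if "x \<in> {1..m}" for x
      using convex_sequence_decomposition[of x m v] m that
      unfolding \<gamma>_def \<beta>_def R_def L_def d_def c_def by (simp add: algebra_simps)
    have R0: "0 \<le> R x" and L0: "0 \<le> L x" for x
      using d0 cm by (auto simp: R_def L_def intro!: sum_nonneg mult_nonneg_nonneg)
    have hinges: "(R x)\<^sup>2 + (L x)\<^sup>2 \<le> 2 * (v x)\<^sup>2 + 4 * \<gamma>\<^sup>2 + 4 * (\<beta>\<^sup>2 * (real m)\<^sup>2)" if x: "x \<in> {1..m}" for x
    proof -
      have "0 \<le> R x * L x" using R0 L0 by simp
      then have "(R x)\<^sup>2 + (L x)\<^sup>2 \<le> (R x + L x)\<^sup>2"
        by (simp add: power2_eq_square algebra_simps)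
      also have "R x + L x = v x - (\<gamma> + \<beta> * real x)" using dec[OF x] by simp
      also have "(v x - (\<gamma> + \<beta> * real x))\<^sup>2 \<le> 2 * (v x)\<^sup>2 + 4 * \<gamma>\<^sup>2 + 4 * (\<beta> * real x)\<^sup>2"
        using zero_le_power2[of "v x + (\<gamma> + \<beta> * real x)"] zero_le_power2[of "\<gamma> - \<beta> * real x"]
        by (simp add: power2_eq_square algebra_simps)
      also have "\<dots> \<le> 2 * (v x)\<^sup>2 + 4 * \<gamma>\<^sup>2 + 4 * (\<beta>\<^sup>2 * (real m)\<^sup>2)"
        unfolding power_mult_distrib using x by (intro add_left_mono mult_left_mono power_mono) auto
      finally show ?thesis .
    qed
    have "(\<Sum>x=1..m. (R x)\<^sup>2) + (\<Sum>x=1..m. (L x)\<^sup>2) = (\<Sum>x=1..m. (R x)\<^sup>2 + (L x)\<^sup>2)"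
      by (rule sum.distrib[symmetric])
    also have "\<dots> \<le> (\<Sum>x=1..m. 2 * (v x)\<^sup>2 + 4 * \<gamma>\<^sup>2 + 4 * (\<beta>\<^sup>2 * (real m)\<^sup>2))"
      by (intro sum_mono hinges)
    also have "\<dots> = 2 * S + 4 * (\<gamma>\<^sup>2 * real m) + 4 * (\<beta>\<^sup>2 * real m ^ 3)"
      by (simp add: S_def sum.distrib sum_distrib_left power3_eq_cube power2_eq_square)
    also have "\<dots> \<le> 1500000 * S" using \<gamma>S \<beta>S nn(1) by linarith
    finally have RL: "(\<Sum>x=1..m. (R x)\<^sup>2) + (\<Sum>x=1..m. (L x)\<^sup>2) \<le> 1500000 * S" .
    have "0 \<le> (\<Sum>x=1..m. (R x)\<^sup>2)" "0 \<le> (\<Sum>x=1..m. (L x)\<^sup>2)" by (auto intro: sum_nonneg)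
    with RL have RS: "(\<Sum>x=1..m. (R x)\<^sup>2) \<le> 1500000 * S" and LS: "(\<Sum>x=1..m. (L x)\<^sup>2) \<le> 1500000 * S"
      by linarith+
    have finK: "finite K" by (simp add: K_def)
    \<comment> \<open>The four pairings carry 240000, 120000 and twice 1500000, all multiplied by 4
      from \<open>square_sum4_le\<close>; the largest resulting weight is 2 * 4 * 1500000 * 24 =
      288000000.\<close>
    have weights: "960000 * z + 480000 * Q + 6000000 * XR + 6000000 * XL + 288000000 * y
        \<le> 300000000 * (y + (E + Q + z + XR + XL))" if "0 \<le> z" "0 \<le> y" for y z :: real
    proof -
      have "0 \<le> 12000000 * y + 300000000 * E + 299520000 * Q + 299040000 * z + 294000000 * XR + 294000000 * XL"
        using nn that by (intro add_nonneg_nonneg mult_nonneg_nonneg) auto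
      then show ?thesis by (simp add: algebra_simps)
    qed
    have T1: "(\<gamma> * W m)\<^sup>2 \<le> 240000 * S * ((W m)\<^sup>2 / real m)"
      using mult_right_mono[OF \<gamma>S nn(4)] m by (simp add: power_mult_distrib)
    have T2: "(\<beta> * (\<Sum>j=1..m. W j))\<^sup>2 \<le> 120000 * S * Q"
    proof -
      have "(\<Sum>j=1..m. W j)\<^sup>2 \<le> (\<Sum>j=1..m. (W j)\<^sup>2) * real m"
        using sum_squared_le_sum_of_squares[of W "{1..m}"] by simp
      also have "\<dots> \<le> (\<Sum>j=1..m. real m * ((W j)\<^sup>2 / real j)) * real m"
      proof (intro mult_right_mono sum_mono)
        fix j assume "j \<in> {1..m}"
        then have "real j \<le> real m" "(W j)\<^sup>2 = real j * ((W j)\<^sup>2 / real j)" by auto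
        then show "(W j)\<^sup>2 \<le> real m * ((W j)\<^sup>2 / real j)"
          using mult_right_mono[of "real j" "real m" "(W j)\<^sup>2 / real j"] by simp
      qed simp
      also have "(\<Sum>j=1..m. real m * ((W j)\<^sup>2 / real j)) = real m * real m * Q"
        unfolding Q_def sum_distrib_left[symmetric] using m by simp
      finally have "(\<Sum>j=1..m. W j)\<^sup>2 \<le> real m ^ 3 * Q"
        by (simp add: power3_eq_cube mult_ac)
      then have "(\<beta> * (\<Sum>j=1..m. W j))\<^sup>2 \<le> \<beta>\<^sup>2 * (real m ^ 3 * Q)"
        unfolding power_mult_distrib by (rule mult_left_mono) simp
      also have "\<dots> \<le> 120000 * S * Q"
        using mult_right_mono[OF \<beta>S nn(3)] by (simp add: mult_ac)
      finally show ?thesis .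
    qed
    have T3: "(\<Sum>x=1..m. e x * R x)\<^sup>2 \<le> 1500000 * S * (24 * (t * card K) + XR)"
    proof -
      \<comment> \<open>Widths seen from the right end: the kink at \<open>t\<close> is a hinge of
        width \<open>m - t\<close>. Restricting to \<open>K\<close> drops the zero coefficients, so
        only true kinks are counted.\<close>
      define A where "A = (\<lambda>t. m - t) ` (K \<inter> {c<..<m})"
      have Rw: "R (m - s) = (\<Sum>l\<in>A. d (m - l) * real (l - s))" for s
      proof -
        have inj: "inj_on (\<lambda>t. m - t) (K \<inter> {c<..<m})" by (auto simp: inj_on_def K_def)
        have "R (m - s) = (\<Sum>t\<in>K \<inter> {c<..<m}. d t * real (m - s - t))"
          unfolding R_def using cm
          by (intro sum.mono_neutral_right) (auto simp: K_def d_def)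
        also have "\<dots> = (\<Sum>l\<in>A. d (m - l) * real (l - s))"
          unfolding A_def sum.reindex[OF inj] by (intro sum.cong) (auto simp: diff_commute)
        finally show ?thesis .
      qed
      have "(\<Sum>x=1..m. e x * R x)\<^sup>2 = (\<Sum>s<m. e (m - s) * R (m - s))\<^sup>2"
        by (simp only: sum_reverse_index)
      also have "\<dots> \<le> (\<Sum>s<m. (R (m - s))\<^sup>2) * (24 * t * card A + XR)"
        unfolding Rw XR_def
        by (rule hinge_bound[OF _ _ t]) (use d0 cm in \<open>auto simp: A_def K_def\<close>)
      also have "\<dots> \<le> 1500000 * S * (24 * (t * card K) + XR)"
      proof (rule mult_mono)
        show "(\<Sum>s<m. (R (m - s))\<^sup>2) \<le> 1500000 * S" using RS by (simp only: sum_reverse_index)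
        have "card A \<le> card (K \<inter> {c<..<m})" unfolding A_def using finK by (intro card_image_le) auto
        also have "\<dots> \<le> card K" using finK by (intro card_mono) auto
        finally have "t * card A \<le> t * card K" using t by (intro mult_left_mono) auto
        then show "24 * t * card A + XR \<le> 24 * (t * card K) + XR" by simp
      qed (use nn t in auto)
      finally show ?thesis .
    qed
    have T4: "(\<Sum>x=1..m. e x * L x)\<^sup>2 \<le> 1500000 * S * (24 * (t * card K) + XL)"
    proof -
      \<comment> \<open>From the left end, x = s + 1 turns (t - x)_+ into (t - 1 - s)_+, a hinge of
        width \<open>t - 1\<close>.\<close>
      define A where "A = (\<lambda>t. t - 1) ` (K \<inter> {1<..c})"
      have Lw: "L (Suc s) = (\<Sum>l\<in>A. d (l + 1) * real (l - s))" for s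
      proof -
        have inj: "inj_on (\<lambda>t. t - 1) (K \<inter> {1<..c})" by (auto simp: inj_on_def K_def)
        have "L (Suc s) = (\<Sum>t\<in>K \<inter> {1<..c}. d t * real (t - Suc s))"
          unfolding L_def using cm
          by (intro sum.mono_neutral_right) (auto simp: K_def d_def)
        also have "\<dots> = (\<Sum>l\<in>A. d (l + 1) * real (l - s))"
          unfolding A_def sum.reindex[OF inj] by (intro sum.cong) auto
        finally show ?thesis .
      qed
      have "(\<Sum>x=1..m. e x * L x)\<^sup>2 = (\<Sum>s<m. e (Suc s) * L (Suc s))\<^sup>2"
        by (simp only: One_nat_def sum.atLeast1_atMost_eq)
      also have "\<dots> \<le> (\<Sum>s<m. (L (Suc s))\<^sup>2) * (24 * t * card A + XL)"
        unfolding Lw XL_def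
        by (rule hinge_bound[OF _ _ t]) (use d0 cm in \<open>auto simp: A_def K_def\<close>)
      also have "\<dots> \<le> 1500000 * S * (24 * (t * card K) + XL)"
      proof (rule mult_mono)
        show "(\<Sum>s<m. (L (Suc s))\<^sup>2) \<le> 1500000 * S"
          using LS by (simp only: One_nat_def sum.atLeast1_atMost_eq)
        have "card A \<le> card (K \<inter> {1<..c})" unfolding A_def using finK by (intro card_image_le) auto
        also have "\<dots> \<le> card K" using finK by (intro card_mono) auto
        finally have "t * card A \<le> t * card K" using t by (intro mult_left_mono) auto
        then show "24 * t * card A + XL \<le> 24 * (t * card K) + XL" by simp
      qed (use nn t in auto)
      finally show ?thesis .
    qed
    \<comment> \<open>With \<open>s\<close> counted from the right end, x = m - s is itself the
      hinge of full width \<open>m\<close>, so the slope term also becomes a sum of partial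
      sums.\<close>
    have "(\<Sum>x=1..m. e x * real x) = (\<Sum>s<m. e (m - s) * real (m - s))"
      by (rule sum_reverse_index)
    also have "\<dots> = (\<Sum>j=1..m. W j)"
      unfolding W_def by (rule sum_hinge_eq_sum_partial_sums) simp
    finally have lin: "(\<Sum>x=1..m. e x * real x) = (\<Sum>j=1..m. W j)" .
    have "(\<Sum>x=1..m. e x * v x) = (\<Sum>x=1..m. \<gamma> * e x + \<beta> * (e x * real x) + e x * R x + e x * L x)"
      by (intro sum.cong refl) (simp add: dec algebra_simps)
    also have "\<dots> = \<gamma> * (\<Sum>x=1..m. e x) + \<beta> * (\<Sum>x=1..m. e x * real x) +
        (\<Sum>x=1..m. e x * R x) + (\<Sum>x=1..m. e x * L x)"
      by (simp add: sum.distrib sum_distrib_left)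
    also have "(\<Sum>x=1..m. e x) = W m" unfolding W_def by (rule sum_reverse_index)
    finally have "(\<Sum>x=1..m. e x * v x)\<^sup>2 =
        (\<gamma> * W m + \<beta> * (\<Sum>j=1..m. W j) + (\<Sum>x=1..m. e x * R x) + (\<Sum>x=1..m. e x * L x))\<^sup>2"
      using lin by simp
    also have "\<dots> \<le> 4 * ((\<gamma> * W m)\<^sup>2 + (\<beta> * (\<Sum>j=1..m. W j))\<^sup>2 +
        (\<Sum>x=1..m. e x * R x)\<^sup>2 + (\<Sum>x=1..m. e x * L x)\<^sup>2)"
      by (rule square_sum4_le)
    also have "\<dots> \<le> 4 * (240000 * S * ((W m)\<^sup>2 / real m) + 120000 * S * Q +
        1500000 * S * (24 * (t * card K) + XR) + 1500000 * S * (24 * (t * card K) + XL))"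
      using T1 T2 T3 T4 by (intro mult_left_mono add_mono) auto
    also have "\<dots> = S * (960000 * ((W m)\<^sup>2 / real m) + 480000 * Q + 6000000 * XR + 6000000 * XL +
        288000000 * (t * card K))"
      by (simp add: algebra_simps)
    also have "\<dots> \<le> S * (300000000 * (t * card K + noise_level t m e))"
      unfolding level by (rule mult_left_mono[OF weights[OF nn(4,7)] nn(1)])
    finally show ?thesis by (simp only: S_def mult_ac)
  qed
qed

subsection \<open>Gaussian noise\<close>

text \<open>Independence of the coordinates enters here alone: every later estimate treats a single
  normal partial sum and adds expectations by linearity.\<close>

lemma normal_coordinate_sum:
  fixes A :: "nat set"
  assumes \<sigma>: "0 < \<sigma>" and A: "A \<subseteq> {1..n}" "A \<noteq> {}"
  shows "distributed (gaussian_noise n \<sigma>) lborel (\<lambda>\<epsilon>. \<Sum>i\<in>A. \<epsilon> i)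
    (normal_density 0 (\<sigma> * sqrt (card A)))"
proof -
  let ?N = "density lborel (\<lambda>x. ennreal (normal_density 0 \<sigma> x))"
  have pN: "prob_space ?N" using \<sigma> by (rule prob_space_normal_density)
  let ?P = "gaussian_noise n \<sigma>"
  interpret P: prob_space ?P
    unfolding gaussian_noise_def by (intro prob_space_PiM pN)
  have finA: "finite A" using A finite_subset by blast
  have rv: "(\<lambda>\<epsilon>. \<epsilon> i) \<in> ?P \<rightarrow>\<^sub>M borel" if "i \<in> {1..n}" for i
    using measurable_component_singleton[OF that, of "\<lambda>_. ?N"]
    unfolding gaussian_noise_def by (simp cong: measurable_cong_sets)
  have law: "distr ?P borel (\<lambda>\<epsilon>. \<epsilon> i) = ?N" if "i \<in> {1..n}" for i
  proof -
    have "distr ?P borel (\<lambda>\<epsilon>. \<epsilon> i) = distr ?P ?N (\<lambda>\<epsilon>. \<epsilon> i)"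
      by (rule distr_cong) auto
    also have "\<dots> = ?N"
      unfolding gaussian_noise_def using pN that by (rule distr_PiM_component)
    finally show ?thesis .
  qed
  have "P.indep_vars (\<lambda>_. borel) (\<lambda>i \<epsilon>. \<epsilon> i) {1..n}"
  proof (subst P.indep_vars_iff_distr_eq_PiM')
    show "{1..n} \<noteq> {}" using A by auto
    have "distr ?P (Pi\<^sub>M {1..n} (\<lambda>_. borel)) (\<lambda>\<epsilon>. \<lambda>i\<in>{1..n}. \<epsilon> i) = distr ?P ?P (\<lambda>\<epsilon>. \<epsilon>)"
    proof (rule distr_cong)
      show "sets (Pi\<^sub>M {1..n} (\<lambda>_. borel)) = sets ?P"
        unfolding gaussian_noise_def by (intro sets_PiM_cong) auto
      show "(\<lambda>i\<in>{1..n}. \<epsilon> i) = \<epsilon>" if "\<epsilon> \<in> space ?P" for \<epsilon>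
        using that unfolding gaussian_noise_def space_PiM by (rule PiE_restrict)
    qed simp
    also have "\<dots> = ?P" by (rule distr_id2) simp
    also have "\<dots> = Pi\<^sub>M {1..n} (\<lambda>i. distr ?P borel (\<lambda>\<epsilon>. \<epsilon> i))"
      unfolding gaussian_noise_def[of n \<sigma>] by (intro PiM_cong refl) (use law in \<open>simp add: gaussian_noise_def\<close>)
    finally show "distr ?P (Pi\<^sub>M {1..n} (\<lambda>_. borel)) (\<lambda>\<epsilon>. \<lambda>i\<in>{1..n}. \<epsilon> i) =
      Pi\<^sub>M {1..n} (\<lambda>i. distr ?P borel (\<lambda>\<epsilon>. \<epsilon> i))" .
  qed (use rv in auto)
  then have "P.indep_vars (\<lambda>_. borel) (\<lambda>i \<epsilon>. \<epsilon> i) A"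
    using A(1) by (rule P.indep_vars_subset)
  then have "distributed ?P lborel (\<lambda>\<epsilon>. \<Sum>i\<in>A. \<epsilon> i)
      (normal_density (\<Sum>i\<in>A. 0) (sqrt (\<Sum>i\<in>A. \<sigma>\<^sup>2)))"
  proof (rule P.sum_indep_normal[OF finA A(2), where \<sigma> = "\<lambda>_. \<sigma>" and \<mu> = "\<lambda>_. 0"])
    fix i assume "i \<in> A"
    then have i: "i \<in> {1..n}" using A by auto
    show "distributed ?P lborel (\<lambda>\<epsilon>. \<epsilon> i) (normal_density 0 \<sigma>)"
      unfolding distributed_def using law[OF i] rv[OF i]
      by (auto simp: cong: distr_cong)
  qed (rule \<sigma>)
  then show ?thesis using \<sigma> by (simp add: real_sqrt_mult mult.commute)
qed

text \<open>The tilt takes away half of the Gaussian exponent, leaving a normal density of doubled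
  variance; the exponential moment is therefore exactly sqrt 2.\<close>

lemma normal_density_times_exp:
  assumes "0 < \<tau>"
  shows "normal_density 0 \<tau> x * exp (x\<^sup>2 / (4 * \<tau>\<^sup>2)) = sqrt 2 * normal_density 0 (sqrt 2 * \<tau>) x"
proof -
  have "exp (- x\<^sup>2 / (2 * \<tau>\<^sup>2)) * exp (x\<^sup>2 / (4 * \<tau>\<^sup>2)) = exp (- x\<^sup>2 / (4 * \<tau>\<^sup>2))"
    unfolding mult_exp_exp using assms by (simp add: field_simps)
  then show ?thesis
    using assms by (simp add: normal_density_def real_sqrt_mult field_simps)
qed

text \<open>Exponential Markov argument: max(0, u) <= a exp(u / a) with a = 4 sigma^2, for which the
  moment is sqrt 2; 6 = 4 * 3/2 bounds 4 sqrt 2.\<close>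

lemma expectation_chi_square_excess:
  fixes A :: "nat set"
  assumes \<sigma>: "0 < \<sigma>" and A: "A \<subseteq> {1..n}" "A \<noteq> {}"
  shows "integrable (gaussian_noise n \<sigma>) (\<lambda>\<epsilon>. max 0 ((\<Sum>i\<in>A. \<epsilon> i)\<^sup>2 / real (card A) - t))" (is "integrable ?P ?f")
    and "(\<integral>\<epsilon>. max 0 ((\<Sum>i\<in>A. \<epsilon> i)\<^sup>2 / real (card A) - t) \<partial>gaussian_noise n \<sigma>)
      \<le> 6 * \<sigma>\<^sup>2 * exp (- t / (4 * \<sigma>\<^sup>2))"
proof -
  define \<tau> where "\<tau> = \<sigma> * sqrt (card A)"
  have finA: "finite A" using A finite_subset by blast
  have cA: "0 < real (card A)" using finA A by (simp add: card_gt_0_iff)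
  have \<tau>: "0 < \<tau>" and \<tau>2: "\<tau>\<^sup>2 = \<sigma>\<^sup>2 * real (card A)"
    using cA \<sigma> by (auto simp: \<tau>_def power_mult_distrib)
  let ?S = "\<lambda>\<epsilon>. \<Sum>i\<in>A. \<epsilon> i"
  let ?g = "\<lambda>x. exp (x\<^sup>2 / (4 * \<tau>\<^sup>2))"
  have D: "distributed ?P lborel ?S (normal_density 0 \<tau>)"
    unfolding \<tau>_def using \<sigma> A by (rule normal_coordinate_sum)
  have S[measurable]: "?S \<in> borel_measurable ?P" using distributed_measurable[OF D] by simp
  have "integrable lborel (\<lambda>x. normal_density 0 \<tau> x * ?g x)"
    unfolding normal_density_times_exp[OF \<tau>] using \<tau> by simp
  then have int: "integrable ?P (\<lambda>\<epsilon>. ?g (?S \<epsilon>))"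
    by (subst (asm) distributed_integrable[OF D]) auto
  have "(\<integral>\<epsilon>. ?g (?S \<epsilon>) \<partial>?P) = (\<integral>x. normal_density 0 \<tau> x * ?g x \<partial>lborel)"
    by (rule distributed_integral[OF D, symmetric]) auto
  also have "\<dots> = sqrt 2"
    unfolding normal_density_times_exp[OF \<tau>] using \<tau> by simp
  finally have val: "(\<integral>\<epsilon>. ?g (?S \<epsilon>) \<partial>?P) = sqrt 2" .
  define c where "c = 4 * \<sigma>\<^sup>2 * exp (- t / (4 * \<sigma>\<^sup>2))"
  have c0: "0 \<le> c" by (simp add: c_def)
  have le: "?f \<epsilon> \<le> c * ?g (?S \<epsilon>)" for \<epsilon>
  proof -
    let ?u = "(?S \<epsilon>)\<^sup>2 / real (card A) - t"
    have "?u / (4 * \<sigma>\<^sup>2) \<le> exp (?u / (4 * \<sigma>\<^sup>2))"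
      using exp_ge_add_one_self[of "?u / (4 * \<sigma>\<^sup>2)"] by linarith
    then have "?u \<le> 4 * \<sigma>\<^sup>2 * exp (?u / (4 * \<sigma>\<^sup>2))"
      using \<sigma> by (simp add: field_simps)
    also have "?u / (4 * \<sigma>\<^sup>2) = - t / (4 * \<sigma>\<^sup>2) + (?S \<epsilon>)\<^sup>2 / (4 * \<tau>\<^sup>2)"
      using \<sigma> cA by (simp add: \<tau>2 field_simps)
    also have "4 * \<sigma>\<^sup>2 * exp (- t / (4 * \<sigma>\<^sup>2) + (?S \<epsilon>)\<^sup>2 / (4 * \<tau>\<^sup>2)) = c * ?g (?S \<epsilon>)"
      by (simp only: c_def exp_add mult.assoc)
    finally show ?thesis using c0 by simp
  qed
  show "integrable ?P ?f"
  proof (rule Bochner_Integration.integrable_bound)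
    show "integrable ?P (\<lambda>\<epsilon>. c * ?g (?S \<epsilon>))" using int by simp
    show "AE \<epsilon> in ?P. norm (?f \<epsilon>) \<le> norm (c * ?g (?S \<epsilon>))" using le c0 by (auto simp: abs_mult)
  qed measurable
  then have "(\<integral>\<epsilon>. ?f \<epsilon> \<partial>?P) \<le> (\<integral>\<epsilon>. c * ?g (?S \<epsilon>) \<partial>?P)"
    using int le by (intro integral_mono) auto
  also have "\<dots> = c * sqrt 2" by (simp add: val)
  also have "\<dots> \<le> c * (3 / 2)"
    using c0 by (intro mult_left_mono real_le_lsqrt) (auto simp: power2_eq_square)
  finally show "(\<integral>\<epsilon>. ?f \<epsilon> \<partial>?P) \<le> 6 * \<sigma>\<^sup>2 * exp (- t / (4 * \<sigma>\<^sup>2))" by (simp add: c_def)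
qed

subsection \<open>Piecewise linear functions\<close>

lemma sq_dist_eq_sum: "sq_dist n u v = (\<Sum>i=1..n. (u i - v i)\<^sup>2)"
  by (simp add: sq_dist_def L2_set_def sum_nonneg)

lemma knots_mono:
  assumes "knots n k N" "i \<le> j" "j \<le> k"
  shows "N i \<le> N j"
  using assms(2,3)
proof (induction j rule: dec_induct)
  case (step j)
  then have "N (Suc j - 1) \<le> N (Suc j)" using assms(1) unfolding knots_def by (metis atLeastAtMost_iff le_add1 plus_1_eq_Suc)
  then show ?case using step by simp
qed simp

lemma knots_piece_exists:
  assumes "knots n k N" "1 \<le> x" "x \<le> n"
  obtains i where "i \<in> {1..k}" "N (i - 1) < x" "x \<le> N i"
proof -
  define i where "i = (LEAST i. x \<le> N i)"
  have k: "x \<le> N k" and 0: "N 0 = 0" using assms by (auto simp: knots_def)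
  have i: "x \<le> N i" unfolding i_def using k by (rule LeastI)
  have "i \<le> k" unfolding i_def using k by (rule Least_le)
  moreover have "i \<noteq> 0" using i 0 assms(2) by (intro notI) simp
  moreover from this have "\<not> x \<le> N (i - 1)" unfolding i_def by (intro not_less_Least) (simp add: i_def[symmetric])
  ultimately show ?thesis using i that[of i] by auto
qed

lemma sum_over_pieces:
  fixes g :: "nat \<Rightarrow> real"
  assumes "knots n k N"
  shows "(\<Sum>x=1..n. g x) = (\<Sum>i=1..k. \<Sum>x=1..N i - N (i - 1). g (N (i - 1) + x))"
proof -
  have "(\<Sum>x=1..N j. g x) = (\<Sum>i=1..j. \<Sum>x=1..N i - N (i - 1). g (N (i - 1) + x))" if "j \<le> k" for j
    using that
  proof (induction j)
    case 0
    then show ?case using assms by (simp add: knots_def)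
  next
    case (Suc j)
    have le: "N j \<le> N (Suc j)" using knots_mono[OF assms] Suc.prems by auto
    have "(\<Sum>x=1..N (Suc j). g x) = (\<Sum>x=1..N j. g x) + (\<Sum>x=N j + 1..N (Suc j). g x)"
      using le by (metis Suc_eq_plus1 le_add2 sum.ub_add_nat le_add_diff_inverse)
    also have "(\<Sum>x=N j + 1..N (Suc j). g x) = (\<Sum>x=1..N (Suc j) - N j. g (N j + x))"
      by (rule sum.reindex_bij_witness[where i = "\<lambda>x. N j + x" and j = "\<lambda>x. x - N j"]) auto
    finally show ?case using Suc by simp
  qed
  from this[of k] show ?thesis using assms by (simp add: knots_def)
qed

text \<open>Continuity at the knots makes every affine piece valid at its left endpoint, too.\<close>

lemma closed_affine_piece:
  assumes f: "piecewise_linear n k N a f" and i: "i \<in> {1..k}" and piece: "N (i - 1) < N i"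
  obtains b where "\<And>x. 1 \<le> x \<Longrightarrow> N (i - 1) \<le> x \<Longrightarrow> x \<le> N i \<Longrightarrow> f (real x / real n) = a i * (real x / real n) + b"
proof -
  have kn: "knots n k N" using f by (simp add: piecewise_linear_def)
  have aff: "affine_with_slope (a i) {real (N (i - 1)) / real n <.. real (N i) / real n} f" if "i \<in> {1..k}" for i
    using f that by (auto simp: piecewise_linear_def)
  obtain b where b: "\<And>y. real (N (i - 1)) / real n < y \<Longrightarrow> y \<le> real (N i) / real n \<Longrightarrow> f y = a i * y + b"
    using aff[OF i] by (auto simp: affine_with_slope_def)
  have Nn: "N i \<le> n" using knots_mono[OF kn, of i k] i kn by (auto simp: knots_def)
  then have n: "0 < n" using piece by simp
  have "f (real x / real n) = a i * (real x / real n) + b" if x: "1 \<le> x" "N (i - 1) \<le> x" "x \<le> N i" for x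
  proof (cases "N (i - 1) = x")
    case False
    then show ?thesis using x n by (intro b) (auto simp: divide_strict_right_mono divide_right_mono)
  next
    case True
    let ?q = "real x / real n"
    \<comment> \<open>The condition \<open>1 \<le> x\<close> excludes the left endpoint 0, which
      lies in no half-open piece, so that \<open>f 0\<close> is arbitrary.\<close>
    have "i - 1 \<noteq> 0" using True x kn by (intro notI) (simp add: knots_def)
    then have "i - 1 \<in> {1..k-1}" using i by auto
    moreover have "0 < N (i - 1)" "N (i - 1) < n" using True x piece Nn by auto
    ultimately obtain L where L: "(f \<longlongrightarrow> L) (at_left ?q)" "(f \<longlongrightarrow> L) (at_right ?q)"
      using f True by (auto simp: piecewise_linear_def)
    \<comment> \<open>At the knot, \<open>f\<close> takes the value of the piece that ends there.
      With repeated knots this need not be piece \<open>i - 1\<close>, so it is located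
      afresh.\<close>
    obtain j where j: "j \<in> {1..k}" "N (j - 1) < x" "x \<le> N j"
      using knots_piece_exists[OF kn, of x] x Nn by force
    obtain b' where b': "\<And>y. real (N (j - 1)) / real n < y \<Longrightarrow> y \<le> real (N j) / real n \<Longrightarrow> f y = a j * y + b'"
      using aff[OF j(1)] by (auto simp: affine_with_slope_def)
    have lt: "real (N (j - 1)) / real n < ?q" and le: "?q \<le> real (N j) / real n"
      using j n by (auto simp: divide_strict_right_mono divide_right_mono)
    have "eventually (\<lambda>y. a j * y + b' = f y) (at_left ?q)"
      using eventually_at_left_real[OF lt] by eventually_elim (use b' le in auto)
    moreover have "((\<lambda>y. a j * y + b') \<longlongrightarrow> a j * ?q + b') (at_left ?q)"
      by (intro tendsto_intros)
    ultimately have "(f \<longlongrightarrow> a j * ?q + b') (at_left ?q)"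
      by (rule Lim_transform_eventually[rotated])
    then have "L = a j * ?q + b'"
      using L(1) by (intro tendsto_unique[OF trivial_limit_at_left_real])
    also have "\<dots> = f ?q" using b' lt le by simp
    finally have 1: "L = f ?q" .
    have lt': "?q < real (N i) / real n" using True piece n by (auto simp: divide_strict_right_mono)
    have "eventually (\<lambda>y. a i * y + b = f y) (at_right ?q)"
      using eventually_at_right_real[OF lt'] by eventually_elim (use b True in auto)
    moreover have "((\<lambda>y. a i * y + b) \<longlongrightarrow> a i * ?q + b) (at_right ?q)"
      by (intro tendsto_intros)
    ultimately have "(f \<longlongrightarrow> a i * ?q + b) (at_right ?q)"
      by (rule Lim_transform_eventually[rotated])
    then have "L = a i * ?q + b"
      using L(2) by (intro tendsto_unique[OF trivial_limit_at_right_real])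
    with 1 show ?thesis by simp
  qed
  then show ?thesis by (rule that)
qed

section \<open>Second differences of vectors in \<open>Theta_star\<close>\<close>

definition second_diff :: "(nat \<Rightarrow> real) \<Rightarrow> nat \<Rightarrow> real" where
  "second_diff \<theta> x = \<theta> (x + 1) - 2 * \<theta> x + \<theta> (x - 1)"

text \<open>Meant for the fixed comparison vector: inside its pieces, estimator minus comparison has
  the second differences of the estimator. The knots obtained here do not depend on the
  noise.\<close>

lemma Theta_star_second_diff_zero:
  assumes "\<theta> \<in> Theta_star n k"
  obtains N where "knots n k N"
    "\<And>i x. i \<in> {1..k} \<Longrightarrow> N (i - 1) + 1 < x \<Longrightarrow> x < N i \<Longrightarrow> second_diff \<theta> x = 0"
proof -
  obtain f N a where f: "piecewise_linear n k N a f" and \<theta>: "\<And>i. i \<in> {1..n} \<Longrightarrow> \<theta> i = f (real i / real n)"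
    using assms by (auto simp: Theta_star_def F_star_def)
  have kn: "knots n k N" using f by (simp add: piecewise_linear_def)
  have "second_diff \<theta> x = 0" if i: "i \<in> {1..k}" and x: "N (i - 1) + 1 < x" "x < N i" for i x
  proof -
    obtain b where b: "\<And>x. 1 \<le> x \<Longrightarrow> N (i - 1) \<le> x \<Longrightarrow> x \<le> N i \<Longrightarrow> f (real x / real n) = a i * (real x / real n) + b"
      using closed_affine_piece[OF f i] x by auto
    have Nn: "N i \<le> n" using knots_mono[OF kn, of i k] i kn by (auto simp: knots_def)
    have "\<theta> (x + 1) = a i * (real (x + 1) / real n) + b" "\<theta> x = a i * (real x / real n) + b"
      "\<theta> (x - 1) = a i * (real (x - 1) / real n) + b"
      using x Nn by (subst \<theta>, force, subst b, auto)+
    then show ?thesis using x by (simp add: second_diff_def add_divide_distrib diff_divide_distrib algebra_simps)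
  qed
  with kn show ?thesis by (rule that)
qed

text \<open>Meant for the estimator. Off the knots, x - 1, x and x + 1 lie in one closed affine
  piece; at a knot the second difference is a jump between ordered slopes. Hence all kinks are
  knots, at most \<open>k\<close> of them.\<close>

lemma Theta_star_second_diff:
  assumes "\<theta> \<in> Theta_star n k"
  shows "\<And>x. 1 < x \<Longrightarrow> x < n \<Longrightarrow> 0 \<le> second_diff \<theta> x"
    and "card {x. 1 < x \<and> x < n \<and> second_diff \<theta> x \<noteq> 0} \<le> k"
proof -
  obtain f N a where f: "piecewise_linear n k N a f" and mono: "mono_on {i \<in> {1..k}. N (i - 1) < N i} a"
    and \<theta>: "\<And>i. i \<in> {1..n} \<Longrightarrow> \<theta> i = f (real i / real n)"
    using assms by (auto simp: Theta_star_def F_star_def)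
  have kn: "knots n k N" using f by (simp add: piecewise_linear_def)
  have key: "0 \<le> second_diff \<theta> x \<and> (x \<notin> N ` {1..k} \<longrightarrow> second_diff \<theta> x = 0)" if x: "1 < x" "x < n" for x
  proof -
    obtain i where i: "i \<in> {1..k}" "N (i - 1) < x" "x \<le> N i"
      using knots_piece_exists[OF kn, of x] x by auto
    obtain b where b: "\<And>x. 1 \<le> x \<Longrightarrow> N (i - 1) \<le> x \<Longrightarrow> x \<le> N i \<Longrightarrow> f (real x / real n) = a i * (real x / real n) + b"
      using closed_affine_piece[OF f i(1)] i by auto
    have 1: "\<theta> x = a i * (real x / real n) + b" "\<theta> (x - 1) = a i * (real (x - 1) / real n) + b"
      using x i by (subst \<theta>, force, subst b, auto)+
    obtain j where j: "j \<in> {1..k}" "N (j - 1) < x + 1" "x + 1 \<le> N j"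
      using knots_piece_exists[OF kn, of "x + 1"] x by auto
    show ?thesis
    proof (cases "x = N i")
      case False
      then have "\<theta> (x + 1) = a i * (real (x + 1) / real n) + b"
        using x i by (subst \<theta>, force, subst b, auto)
      then have "second_diff \<theta> x = 0"
        using 1 x by (simp add: second_diff_def add_divide_distrib diff_divide_distrib algebra_simps)
      then show ?thesis by simp
    next
      case True
      obtain b' where b': "\<And>x. 1 \<le> x \<Longrightarrow> N (j - 1) \<le> x \<Longrightarrow> x \<le> N j \<Longrightarrow> f (real x / real n) = a j * (real x / real n) + b'"
        using closed_affine_piece[OF f j(1)] j by auto
      have 2: "\<theta> (x + 1) = a j * (real (x + 1) / real n) + b'" "\<theta> x = a j * (real x / real n) + b'"
        using x j by (subst \<theta>, force, subst b', auto)+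
      \<comment> \<open>Empty pieces may separate \<open>i\<close> from \<open>j\<close>;
        monotonicity over the nonempty ones compares their slopes directly.\<close>
      have "i \<le> j" using knots_mono[OF kn, of j i] j i True by force
      then have "a i \<le> a j" using mono i j by (intro mono_onD[OF mono]) auto
      then have "a i / real n \<le> a j / real n" by (rule divide_right_mono) simp
      moreover have "second_diff \<theta> x = (\<theta> (x + 1) - \<theta> x) - (\<theta> x - \<theta> (x - 1))"
        by (simp add: second_diff_def)
      moreover have "\<theta> (x + 1) - \<theta> x = a j / real n"
        using 2 by (simp add: add_divide_distrib algebra_simps)
      moreover have "\<theta> x - \<theta> (x - 1) = a i / real n"
        using 1 x by (simp add: diff_divide_distrib algebra_simps)
      ultimately have "0 \<le> second_diff \<theta> x" by linarith
      then show ?thesis using True i by auto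
    qed
  qed
  then show "0 \<le> second_diff \<theta> x" if "1 < x" "x < n" for x using that by auto
  have "card {x. 1 < x \<and> x < n \<and> second_diff \<theta> x \<noteq> 0} \<le> card (N ` {1..k})"
    using key by (intro card_mono) auto
  also have "\<dots> \<le> k" using card_image_le[of "{1..k}" N] by simp
  finally show "card {x. 1 < x \<and> x < n \<and> second_diff \<theta> x \<noteq> 0} \<le> k" .
qed

subsection \<open>Aggregation over the pieces\<close>

text \<open>It depends on the noise and on the knots of the comparison vector, but not on the
  estimator; this is what lets its expectation be computed term by term.\<close>

definition total_noise :: "real \<Rightarrow> nat \<Rightarrow> (nat \<Rightarrow> nat) \<Rightarrow> (nat \<Rightarrow> real) \<Rightarrow> real" where
  "total_noise t k N \<epsilon> = (\<Sum>i | i \<in> {1..k} \<and> N (i - 1) < N i.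
     noise_level t (N i - N (i - 1)) (\<lambda>x. \<epsilon> (N (i - 1) + x)))"

lemma noise_level_nonneg: "0 \<le> noise_level t m e"
  unfolding noise_level_def by (intro add_nonneg_nonneg divide_nonneg_nonneg sum_nonneg excess_nonneg) auto

lemma total_noise_nonneg: "0 \<le> total_noise t k N \<epsilon>"
  unfolding total_noise_def by (intro sum_nonneg noise_level_nonneg)

lemma square_sum_le_sum_times_sum:
  fixes p r q :: "'a \<Rightarrow> real"
  assumes "\<And>i. i \<in> I \<Longrightarrow> (p i)\<^sup>2 \<le> r i * q i" "\<And>i. i \<in> I \<Longrightarrow> 0 \<le> r i" "\<And>i. i \<in> I \<Longrightarrow> 0 \<le> q i"
  shows "(\<Sum>i\<in>I. p i)\<^sup>2 \<le> (\<Sum>i\<in>I. r i) * (\<Sum>i\<in>I. q i)"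
proof -
  have "\<bar>\<Sum>i\<in>I. p i\<bar> \<le> (\<Sum>i\<in>I. \<bar>p i\<bar>)" by (rule sum_abs)
  also have "\<dots> \<le> (\<Sum>i\<in>I. sqrt (r i) * sqrt (q i))"
    using assms by (intro sum_mono) (auto simp: real_sqrt_mult[symmetric] intro!: real_le_rsqrt)
  finally have "(\<Sum>i\<in>I. p i)\<^sup>2 \<le> (\<Sum>i\<in>I. sqrt (r i) * sqrt (q i))\<^sup>2"
    using power_mono[of "\<bar>\<Sum>i\<in>I. p i\<bar>" _ 2] by simp
  also have "\<dots> \<le> (\<Sum>i\<in>I. (sqrt (r i))\<^sup>2) * (\<Sum>i\<in>I. (sqrt (q i))\<^sup>2)"
    by (rule Cauchy_Schwarz_ineq_sum)
  also have "\<dots> = (\<Sum>i\<in>I. r i) * (\<Sum>i\<in>I. q i)" using assms by simp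
  finally show ?thesis .
qed

text \<open>Cauchy-Schwarz over the pieces. Since the pieces are disjoint, the kinks of
  \<open>\<theta>\<close> inside them number at most \<open>k\<close> in total, so the threshold is
  paid \<open>k\<close> times altogether rather than \<open>k\<close> times per piece.\<close>

lemma noise_correlation_bound:
  fixes \<epsilon> \<theta> \<theta>' :: "nat \<Rightarrow> real"
  assumes \<theta>: "\<theta> \<in> Theta_star n k" and kn: "knots n k N"
    and \<theta>': "\<And>i x. i \<in> {1..k} \<Longrightarrow> N (i - 1) + 1 < x \<Longrightarrow> x < N i \<Longrightarrow> second_diff \<theta>' x = 0"
    and t: "0 \<le> t"
  shows "(\<Sum>x=1..n. \<epsilon> x * (\<theta> x - \<theta>' x))\<^sup>2 \<le>
    (\<Sum>x=1..n. (\<theta> x - \<theta>' x)\<^sup>2) * (300000000 * (t * k + total_noise t k N \<epsilon>))"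
proof -
  define I where "I = {i. i \<in> {1..k} \<and> N (i - 1) < N i}"
  define m where "m i = N i - N (i - 1)" for i
  define v where "v i x = \<theta> (N (i - 1) + x) - \<theta>' (N (i - 1) + x)" for i x
  define e where "e i x = \<epsilon> (N (i - 1) + x)" for i x
  define K where "K i = {x. 1 < x \<and> x < m i \<and> v i (x + 1) - 2 * v i x + v i (x - 1) \<noteq> 0}" for i
  define D where "D = {x. 1 < x \<and> x < n \<and> second_diff \<theta> x \<noteq> 0}"
  have finI: "finite I" and I_sub: "I \<subseteq> {1..k}" by (auto simp: I_def)
  have Nn: "N i \<le> n" if "i \<in> {1..k}" for i
    using knots_mono[OF kn, of i k] that kn by (auto simp: knots_def)
  have pieces: "(\<Sum>x=1..n. g x) = (\<Sum>i\<in>I. \<Sum>x=1..m i. g (N (i - 1) + x))" for g :: "nat \<Rightarrow> real"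
  proof -
    have "(\<Sum>x=1..m i. g (N (i - 1) + x)) = 0" if "i \<in> {1..k} - I" for i
      using that by (simp add: I_def m_def not_less)
    then show ?thesis
      unfolding sum_over_pieces[OF kn] m_def[symmetric] using I_sub
      by (intro sum.mono_neutral_right) auto
  qed
  have diff: "v i (x + 1) - 2 * v i x + v i (x - 1) = second_diff \<theta> (N (i - 1) + x)"
    if "i \<in> I" "1 < x" "x < m i" for i x
  proof -
    have "second_diff \<theta>' (N (i - 1) + x) = 0" using that by (intro \<theta>'[of i]) (auto simp: I_def m_def)
    moreover have "N (i - 1) + x - 1 = N (i - 1) + (x - 1)" using that by simp
    ultimately show ?thesis by (simp add: v_def second_diff_def)
  qed
  have inside: "1 < N (i - 1) + x \<and> N (i - 1) + x < n" if "i \<in> I" "1 < x" "x < m i" for i x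
    using Nn[of i] that by (auto simp: I_def m_def)
  \<comment> \<open>Kinks are counted as sums of indicators, so that \<open>pieces\<close> merges
    the counts into one over \<open>{1..n}\<close>.\<close>
  have "(\<Sum>i\<in>I. real (card (K i))) \<le> (\<Sum>i\<in>I. \<Sum>x=1..m i. if N (i - 1) + x \<in> D then 1 else 0)"
  proof (intro sum_mono)
    fix i assume i: "i \<in> I"
    have "card (K i) \<le> card {x \<in> {1..m i}. N (i - 1) + x \<in> D}"
      using diff[OF i] inside[OF i] by (intro card_mono) (auto simp: K_def D_def)
    then show "real (card (K i)) \<le> (\<Sum>x=1..m i. if N (i - 1) + x \<in> D then 1 else 0)"
      by (simp add: sum.If_cases Int_def)
  qed
  also have "\<dots> = (\<Sum>x=1..n. if x \<in> D then 1 else 0)" by (rule pieces[symmetric])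
  also have "\<dots> = real (card D)"
    by (simp add: sum.If_cases) (rule arg_cong[where f = card], auto simp: D_def)
  also have "\<dots> \<le> real k" unfolding D_def using Theta_star_second_diff(2)[OF \<theta>] by (rule of_nat_mono)
  finally have cardK: "(\<Sum>i\<in>I. real (card (K i))) \<le> real k" .
  let ?q = "\<lambda>i. 300000000 * (t * card (K i) + noise_level t (m i) (e i))"
  have "(\<Sum>x=1..n. \<epsilon> x * (\<theta> x - \<theta>' x))\<^sup>2 = (\<Sum>i\<in>I. \<Sum>x=1..m i. e i x * v i x)\<^sup>2"
    unfolding pieces by (simp add: v_def e_def)
  also have "\<dots> \<le> (\<Sum>i\<in>I. \<Sum>x=1..m i. (v i x)\<^sup>2) * (\<Sum>i\<in>I. ?q i)"
  proof (rule square_sum_le_sum_times_sum)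
    fix i assume i: "i \<in> I"
    have "0 \<le> v i (x + 1) - 2 * v i x + v i (x - 1)" if "1 < x" "x < m i" for x
      using diff[OF i that] inside[OF i that] Theta_star_second_diff(1)[OF \<theta>] by simp
    then have "(\<Sum>x=1..m i. e i x * v i x)\<^sup>2 \<le>
        300000000 * (\<Sum>x=1..m i. (v i x)\<^sup>2) * (t * card (K i) + noise_level t (m i) (e i))"
      unfolding K_def using t by (intro convex_sequence_bound)
    then show "(\<Sum>x=1..m i. e i x * v i x)\<^sup>2 \<le> (\<Sum>x=1..m i. (v i x)\<^sup>2) * ?q i"
      by (simp only: mult_ac)
  qed (use t in \<open>auto intro!: sum_nonneg add_nonneg_nonneg noise_level_nonneg\<close>)
  also have "(\<Sum>i\<in>I. \<Sum>x=1..m i. (v i x)\<^sup>2) = (\<Sum>x=1..n. (\<theta> x - \<theta>' x)\<^sup>2)"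
    unfolding pieces by (simp add: v_def)
  also have "(\<Sum>i\<in>I. ?q i) = 300000000 * (t * (\<Sum>i\<in>I. real (card (K i))) + total_noise t k N \<epsilon>)"
    unfolding total_noise_def I_def[symmetric] m_def e_def
    by (simp add: sum.distrib sum_distrib_left)
  also have "(\<Sum>x=1..n. (\<theta> x - \<theta>' x)\<^sup>2) * \<dots> \<le>
      (\<Sum>x=1..n. (\<theta> x - \<theta>' x)\<^sup>2) * (300000000 * (t * k + total_noise t k N \<epsilon>))"
    using cardK t by (intro mult_left_mono add_right_mono sum_nonneg) auto
  finally show ?thesis .
qed

section \<open>Expected noise, from one partial sum to all pieces\<close>

lemma card_dyadic_scales_le:
  assumes "1 \<le> m"
  shows "real (card {b::nat. 2 ^ b \<le> m}) \<le> 2 * (1 + ln (real m))"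
proof -
  have sub: "{b::nat. 2 ^ b \<le> m} \<subseteq> {..floor_log m}"
  proof
    fix b :: nat assume "b \<in> {b. 2 ^ b \<le> m}"
    then have "floor_log (2 ^ b) \<le> floor_log m" by (intro monoD[OF floor_log_mono]) simp
    then show "b \<in> {..floor_log m}" by simp
  qed
  have "real (card {b::nat. 2 ^ b \<le> m}) \<le> real (floor_log m) + 1"
    using card_mono[OF _ sub] by simp
  moreover have "real (floor_log m) * (2 / 3) \<le> ln (real m)"
  proof -
    have "real (floor_log m) * (2 / 3) \<le> real (floor_log m) * ln 2"
      by (intro mult_left_mono ln2_ge_two_thirds) simp
    also have "\<dots> = ln (2 ^ floor_log m)" by (simp add: ln_realpow)
    also have "\<dots> \<le> ln (real m)"
    proof -
      have "real (2 ^ floor_log m) \<le> real m" using assms floor_log_exp2_le[of m] by (intro of_nat_mono) simp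
      then show ?thesis using assms by simp
    qed
    finally show ?thesis .
  qed
  moreover have "0 \<le> ln (real m)" using assms by simp
  ultimately show ?thesis by argo
qed

context
  fixes n :: nat and \<sigma> :: real
  assumes \<sigma>: "0 < \<sigma>"
begin

text \<open>The reindexing \<open>g\<close> covers partial sums read from either end of a piece at
  any offset.\<close>

lemma expectation_partial_sum_excess:
  assumes "A \<subseteq> {1..n}" "A \<noteq> {}" "inj_on g B" "g ` B = A" "card B = j"
  shows "integrable (gaussian_noise n \<sigma>) (\<lambda>\<epsilon>. max 0 ((\<Sum>s\<in>B. \<epsilon> (g s))\<^sup>2 / real j - t))"
    and "(\<integral>\<epsilon>. max 0 ((\<Sum>s\<in>B. \<epsilon> (g s))\<^sup>2 / real j - t) \<partial>gaussian_noise n \<sigma>)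
      \<le> 6 * \<sigma>\<^sup>2 * exp (- t / (4 * \<sigma>\<^sup>2))"
proof -
  have "(\<Sum>s\<in>B. \<epsilon> (g s)) = (\<Sum>i\<in>A. \<epsilon> i)" for \<epsilon> :: "nat \<Rightarrow> real"
    using assms by (auto simp: sum.reindex)
  moreover have "j = card A" using assms by (auto simp: card_image)
  ultimately show "integrable (gaussian_noise n \<sigma>) (\<lambda>\<epsilon>. max 0 ((\<Sum>s\<in>B. \<epsilon> (g s))\<^sup>2 / real j - t))"
    "(\<integral>\<epsilon>. max 0 ((\<Sum>s\<in>B. \<epsilon> (g s))\<^sup>2 / real j - t) \<partial>gaussian_noise n \<sigma>)
      \<le> 6 * \<sigma>\<^sup>2 * exp (- t / (4 * \<sigma>\<^sup>2))"
    using expectation_chi_square_excess[OF \<sigma> assms(1,2)] by simp_all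
qed

text \<open>At threshold 0 the excess is the square itself, so the exponential bound also serves for
  second moments.\<close>

lemma expectation_partial_sum_square:
  assumes "A \<subseteq> {1..n}" "A \<noteq> {}" "inj_on g B" "g ` B = A" "card B = j"
  shows "integrable (gaussian_noise n \<sigma>) (\<lambda>\<epsilon>. (\<Sum>s\<in>B. \<epsilon> (g s))\<^sup>2 / real j)"
    and "(\<integral>\<epsilon>. (\<Sum>s\<in>B. \<epsilon> (g s))\<^sup>2 / real j \<partial>gaussian_noise n \<sigma>) \<le> 6 * \<sigma>\<^sup>2"
  using expectation_partial_sum_excess[OF assms, of 0] by simp_all

text \<open>A scale has at most 2 * 2^b terms of weight 12 / 2^b, so each scale costs at most 24
  single excesses, whatever \<open>b\<close> is; 144 = 24 * 6.\<close>

lemma expectation_excess: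
  assumes g: "inj_on g {..<m}" "g ` {..<m} \<subseteq> {1..n}"
  shows "integrable (gaussian_noise n \<sigma>) (\<lambda>\<epsilon>. excess t m (\<lambda>s. \<epsilon> (g s)))"
    and "(\<integral>\<epsilon>. excess t m (\<lambda>s. \<epsilon> (g s)) \<partial>gaussian_noise n \<sigma>)
      \<le> 144 * \<sigma>\<^sup>2 * exp (- t / (4 * \<sigma>\<^sup>2)) * card {b::nat. 2 ^ b \<le> m}"
proof -
  let ?P = "gaussian_noise n \<sigma>"
  let ?X = "\<lambda>j \<epsilon>. max 0 ((\<Sum>s<j. \<epsilon> (g s))\<^sup>2 / real j - t)"
  let ?J = "\<lambda>b. {1..min m (2 ^ Suc b)}"
  define c where "c = 6 * \<sigma>\<^sup>2 * exp (- t / (4 * \<sigma>\<^sup>2))"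
  have c0: "0 \<le> c" by (simp add: c_def)
  have X: "integrable ?P (?X j)" "(\<integral>\<epsilon>. ?X j \<epsilon> \<partial>?P) \<le> c" if "j \<in> ?J b" for j b
    unfolding c_def
    by (rule expectation_partial_sum_excess[of "g ` {..<j}"];
        use g that in \<open>auto simp: inj_on_def lessThan_empty_iff bot_nat_def\<close>)+
  show "integrable ?P (\<lambda>\<epsilon>. excess t m (\<lambda>s. \<epsilon> (g s)))"
    unfolding excess_def by (intro Bochner_Integration.integrable_sum integrable_mult_right X)
  have "(\<integral>\<epsilon>. excess t m (\<lambda>s. \<epsilon> (g s)) \<partial>?P) =
      (\<Sum>b | 2 ^ b \<le> m. 12 / 2 ^ b * (\<Sum>j\<in>?J b. \<integral>\<epsilon>. ?X j \<epsilon> \<partial>?P))"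
    unfolding excess_def
    by (subst Bochner_Integration.integral_sum, intro integrable_mult_right Bochner_Integration.integrable_sum X, assumption)
       (intro sum.cong refl, subst integral_mult_right_zero, subst Bochner_Integration.integral_sum, auto intro: X)
  also have "\<dots> \<le> (\<Sum>b | 2 ^ b \<le> m. 24 * c)"
  proof (intro sum_mono)
    fix b :: nat assume "b \<in> {b. 2 ^ b \<le> m}"
    have "(\<Sum>j\<in>?J b. \<integral>\<epsilon>. ?X j \<epsilon> \<partial>?P) \<le> (\<Sum>j\<in>?J b. c)" by (intro sum_mono X)
    also have "\<dots> = real (card (?J b)) * c" by simp
    also have "\<dots> \<le> real (2 ^ Suc b) * c" using c0 by (intro mult_right_mono of_nat_mono) auto
    finally have "12 / 2 ^ b * (\<Sum>j\<in>?J b. \<integral>\<epsilon>. ?X j \<epsilon> \<partial>?P) \<le> 12 / 2 ^ b * (real (2 ^ Suc b) * c)"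
      by (rule mult_left_mono) simp
    then show "12 / 2 ^ b * (\<Sum>j\<in>?J b. \<integral>\<epsilon>. ?X j \<epsilon> \<partial>?P) \<le> 24 * c" by simp
  qed
  finally show "(\<integral>\<epsilon>. excess t m (\<lambda>s. \<epsilon> (g s)) \<partial>?P)
      \<le> 144 * \<sigma>\<^sup>2 * exp (- t / (4 * \<sigma>\<^sup>2)) * card {b::nat. 2 ^ b \<le> m}"
    by (simp add: c_def mult_ac)
qed

text \<open>Here 18 = 6 + 6 + 6 comes from the two means and W_m^2 / m, and 576 = 2 * 144 * 2 from
  the two ends and the count of scales.\<close>

lemma expectation_noise_level:
  assumes m: "1 \<le> m" and pm: "p + m \<le> n"
  shows "integrable (gaussian_noise n \<sigma>) (\<lambda>\<epsilon>. noise_level t m (\<lambda>x. \<epsilon> (p + x)))"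
    and "(\<integral>\<epsilon>. noise_level t m (\<lambda>x. \<epsilon> (p + x)) \<partial>gaussian_noise n \<sigma>)
      \<le> 18 * \<sigma>\<^sup>2 + 576 * \<sigma>\<^sup>2 * exp (- t / (4 * \<sigma>\<^sup>2)) * (1 + ln (real m))"
proof -
  let ?P = "gaussian_noise n \<sigma>"
  let ?c = "144 * \<sigma>\<^sup>2 * exp (- t / (4 * \<sigma>\<^sup>2)) * card {b::nat. 2 ^ b \<le> m}"
  define E where "E x \<epsilon> = (\<epsilon> (p + x))\<^sup>2" for x and \<epsilon> :: "nat \<Rightarrow> real"
  define Q where "Q j \<epsilon> = (\<Sum>s<j. \<epsilon> (p + (m - s)))\<^sup>2 / real j" for j and \<epsilon> :: "nat \<Rightarrow> real"
  define XR where "XR \<epsilon> = excess t m (\<lambda>s. \<epsilon> (p + (m - s)))" for \<epsilon> :: "nat \<Rightarrow> real"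
  define XL where "XL \<epsilon> = excess t m (\<lambda>s. \<epsilon> (p + Suc s))" for \<epsilon> :: "nat \<Rightarrow> real"
  have eq: "noise_level t m (\<lambda>x. \<epsilon> (p + x)) =
      ((\<Sum>x=1..m. E x \<epsilon>) + (\<Sum>j=1..m. Q j \<epsilon>)) / real m + Q m \<epsilon> + XR \<epsilon> + XL \<epsilon>" for \<epsilon>
    by (simp add: noise_level_def E_def Q_def XR_def XL_def)
  have E: "integrable ?P (E x)" "(\<integral>\<epsilon>. E x \<epsilon> \<partial>?P) \<le> 6 * \<sigma>\<^sup>2" if "x \<in> {1..m}" for x
    using expectation_partial_sum_square[of "{p + x}" "\<lambda>_. p + x" "{0::nat}" 1] that pm
    by (auto simp: E_def[abs_def])
  have Q: "integrable ?P (Q j)" "(\<integral>\<epsilon>. Q j \<epsilon> \<partial>?P) \<le> 6 * \<sigma>\<^sup>2" if "j \<in> {1..m}" for j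
    unfolding Q_def
    by (rule expectation_partial_sum_square[of "(\<lambda>s. p + (m - s)) ` {..<j}"];
        use that pm in \<open>auto simp: inj_on_def lessThan_empty_iff bot_nat_def\<close>)+
  have XR: "integrable ?P XR" "(\<integral>\<epsilon>. XR \<epsilon> \<partial>?P) \<le> ?c"
    unfolding XR_def by (rule expectation_excess; use pm in \<open>auto simp: inj_on_def\<close>)+
  have XL: "integrable ?P XL" "(\<integral>\<epsilon>. XL \<epsilon> \<partial>?P) \<le> ?c"
    unfolding XL_def by (rule expectation_excess; use pm in \<open>auto simp: inj_on_def\<close>)+
  have mm: "m \<in> {1..m}" using m by simp
  have iE: "integrable ?P (\<lambda>\<epsilon>. \<Sum>x=1..m. E x \<epsilon>)" and iQ: "integrable ?P (\<lambda>\<epsilon>. \<Sum>j=1..m. Q j \<epsilon>)"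
    by (intro Bochner_Integration.integrable_sum E Q; simp)+
  show "integrable ?P (\<lambda>\<epsilon>. noise_level t m (\<lambda>x. \<epsilon> (p + x)))"
    unfolding eq using iE iQ Q(1)[OF mm] XR(1) XL(1) by (intro Bochner_Integration.integrable_add integrable_divide_zero)
  have "(\<Sum>x=1..m. \<integral>\<epsilon>. E x \<epsilon> \<partial>?P) \<le> (\<Sum>x=1..m. 6 * \<sigma>\<^sup>2)" by (intro sum_mono E)
  moreover have "(\<Sum>j=1..m. \<integral>\<epsilon>. Q j \<epsilon> \<partial>?P) \<le> (\<Sum>j=1..m. 6 * \<sigma>\<^sup>2)" by (intro sum_mono Q)
  ultimately have "((\<Sum>x=1..m. \<integral>\<epsilon>. E x \<epsilon> \<partial>?P) + (\<Sum>j=1..m. \<integral>\<epsilon>. Q j \<epsilon> \<partial>?P)) / real m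
      \<le> ((\<Sum>x=1..m. 6 * \<sigma>\<^sup>2) + (\<Sum>j=1..m. 6 * \<sigma>\<^sup>2)) / real m"
    by (intro divide_right_mono add_mono) auto
  also have "\<dots> = 12 * \<sigma>\<^sup>2" using m by (simp add: field_simps)
  finally have mean: "((\<Sum>x=1..m. \<integral>\<epsilon>. E x \<epsilon> \<partial>?P) + (\<Sum>j=1..m. \<integral>\<epsilon>. Q j \<epsilon> \<partial>?P)) / real m \<le> 12 * \<sigma>\<^sup>2" .
  have "(\<integral>\<epsilon>. noise_level t m (\<lambda>x. \<epsilon> (p + x)) \<partial>?P) =
      ((\<Sum>x=1..m. \<integral>\<epsilon>. E x \<epsilon> \<partial>?P) + (\<Sum>j=1..m. \<integral>\<epsilon>. Q j \<epsilon> \<partial>?P)) / real m +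
      (\<integral>\<epsilon>. Q m \<epsilon> \<partial>?P) + (\<integral>\<epsilon>. XR \<epsilon> \<partial>?P) + (\<integral>\<epsilon>. XL \<epsilon> \<partial>?P)"
    unfolding eq using iE iQ Q mm XR(1) XL(1) E
    by (simp add: Bochner_Integration.integral_sum)
  also have "\<dots> \<le> 12 * \<sigma>\<^sup>2 + 6 * \<sigma>\<^sup>2 + ?c + ?c"
    using mean Q(2)[OF mm] XR(2) XL(2) by linarith
  also have "\<dots> = 18 * \<sigma>\<^sup>2 + 288 * \<sigma>\<^sup>2 * exp (- t / (4 * \<sigma>\<^sup>2)) * card {b::nat. 2 ^ b \<le> m}" by simp
  also have "\<dots> \<le> 18 * \<sigma>\<^sup>2 + 288 * \<sigma>\<^sup>2 * exp (- t / (4 * \<sigma>\<^sup>2)) * (2 * (1 + ln (real m)))"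
    using card_dyadic_scales_le[OF m] by (intro add_left_mono mult_left_mono) auto
  finally show "(\<integral>\<epsilon>. noise_level t m (\<lambda>x. \<epsilon> (p + x)) \<partial>?P)
      \<le> 18 * \<sigma>\<^sup>2 + 576 * \<sigma>\<^sup>2 * exp (- t / (4 * \<sigma>\<^sup>2)) * (1 + ln (real m))"
    by (simp add: algebra_simps)
qed

text \<open>The threshold is chosen to make the exponential factor equal to
  \<open>1 / \<kappa>\<close>, which cancels the count of scales, of order
  \<open>k * \<kappa>\<close>; 594 = 18 + 576. Since ln 16 >= 1, \<open>\<kappa>\<close> dominates 1
  + ln (n / k).\<close>

lemma expectation_total_noise:
  fixes k :: nat
  defines "\<kappa> \<equiv> ln (16 * real n / real k)"
  assumes kn: "knots n k N" and k: "1 \<le> k" "k \<le> n"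
  shows "integrable (gaussian_noise n \<sigma>) (total_noise (4 * \<sigma>\<^sup>2 * ln \<kappa>) k N)"
    and "(\<integral>\<epsilon>. total_noise (4 * \<sigma>\<^sup>2 * ln \<kappa>) k N \<epsilon> \<partial>gaussian_noise n \<sigma>) \<le> 594 * \<sigma>\<^sup>2 * real k"
proof -
  let ?P = "gaussian_noise n \<sigma>"
  define t where "t = 4 * \<sigma>\<^sup>2 * ln \<kappa>"
  define I where "I = {i. i \<in> {1..k} \<and> N (i - 1) < N i}"
  define m where "m i = N i - N (i - 1)" for i
  have finI: "finite I" and I_sub: "I \<subseteq> {1..k}" by (auto simp: I_def)
  have cardI: "real (card I) \<le> real k" using card_mono[OF _ I_sub] by simp
  have m1: "1 \<le> m i" "N (i - 1) + m i \<le> n" if "i \<in> I" for i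
    using that knots_mono[OF kn, of i k] kn by (auto simp: I_def m_def knots_def)
  have "\<kappa> = ln (16 * (real n / real k))" by (simp add: \<kappa>_def)
  also have "\<dots> = ln 16 + ln (real n / real k)" using k by (intro ln_mult_pos) auto
  finally have \<kappa>_eq: "\<kappa> = ln 16 + ln (real n / real k)" .
  have "ln (2 ^ 4) = 4 * ln (2::real)" by (subst ln_realpow) auto
  then have "1 \<le> ln (16::real)" using ln2_ge_two_thirds by simp
  moreover have nk: "0 \<le> ln (real n / real k)" using k by simp
  ultimately have \<kappa>: "0 < \<kappa>" "1 + ln (real n / real k) \<le> \<kappa>" by (simp_all add: \<kappa>_eq)
  have "exp (- t / (4 * \<sigma>\<^sup>2)) = exp (- ln \<kappa>)" using \<sigma> by (simp add: t_def)
  then have exp_t: "exp (- t / (4 * \<sigma>\<^sup>2)) = 1 / \<kappa>"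
    using \<kappa> by (simp add: exp_minus inverse_eq_divide)
  have sum_m: "(\<Sum>i\<in>I. real (m i)) \<le> real n"
  proof -
    have "(\<Sum>i\<in>I. real (m i)) \<le> (\<Sum>i=1..k. real (m i))" using I_sub by (intro sum_mono2) auto
    also have "\<dots> = real n" using sum_over_pieces[OF kn, of "\<lambda>_. 1"] by (simp add: m_def)
    finally show ?thesis .
  qed
  \<comment> \<open>Concavity of ln by its tangent at the average length n / k: ln u <= u - 1 with u
    = k m_i / n.\<close>
  have "(\<Sum>i\<in>I. 1 + ln (real (m i))) \<le> (\<Sum>i\<in>I. real k / real n * real (m i) + ln (real n / real k))"
  proof (rule sum_mono)
    fix i assume "i \<in> I"
    then have "0 < m i" using m1(1)[of i] by simp
    then have pos: "0 < real k / real n * real (m i)" using k by simp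
    have "ln (real (m i)) = ln (real k / real n * real (m i) * (real n / real k))"
      using k by simp
    also have "\<dots> = ln (real k / real n * real (m i)) + ln (real n / real k)"
      using pos k by (intro ln_mult_pos) auto
    finally show "1 + ln (real (m i)) \<le> real k / real n * real (m i) + ln (real n / real k)"
      using ln_le_minus_one[OF pos] by linarith
  qed
  also have "\<dots> = real k / real n * (\<Sum>i\<in>I. real (m i)) + real (card I) * ln (real n / real k)"
    by (simp add: sum.distrib sum_distrib_left)
  also have "\<dots> \<le> real k / real n * real n + real k * ln (real n / real k)"
    using sum_m cardI nk by (intro add_mono mult_left_mono mult_right_mono) auto
  also have "\<dots> = real k * (1 + ln (real n / real k))" using k by (simp add: algebra_simps)
  also have "\<dots> \<le> real k * \<kappa>" using \<kappa> by (intro mult_left_mono) auto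
  finally have logs: "(\<Sum>i\<in>I. 1 + ln (real (m i))) \<le> real k * \<kappa>" .
  have eq: "total_noise t k N \<epsilon> = (\<Sum>i\<in>I. noise_level t (m i) (\<lambda>x. \<epsilon> (N (i - 1) + x)))" for \<epsilon>
    by (simp add: total_noise_def I_def m_def)
  have "integrable ?P (\<lambda>\<epsilon>. total_noise t k N \<epsilon>)"
    unfolding eq by (intro Bochner_Integration.integrable_sum expectation_noise_level m1)
  then show "integrable ?P (total_noise (4 * \<sigma>\<^sup>2 * ln \<kappa>) k N)" by (simp add: t_def)
  have "(\<integral>\<epsilon>. total_noise t k N \<epsilon> \<partial>?P) =
      (\<Sum>i\<in>I. \<integral>\<epsilon>. noise_level t (m i) (\<lambda>x. \<epsilon> (N (i - 1) + x)) \<partial>?P)"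
    unfolding eq by (intro Bochner_Integration.integral_sum expectation_noise_level m1)
  also have "\<dots> \<le> (\<Sum>i\<in>I. 18 * \<sigma>\<^sup>2 + 576 * \<sigma>\<^sup>2 * exp (- t / (4 * \<sigma>\<^sup>2)) * (1 + ln (real (m i))))"
    by (intro sum_mono expectation_noise_level m1)
  also have "\<dots> = 18 * \<sigma>\<^sup>2 * real (card I) + 576 * \<sigma>\<^sup>2 / \<kappa> * (\<Sum>i\<in>I. 1 + ln (real (m i)))"
    unfolding exp_t sum.distrib[of "\<lambda>_. 18 * \<sigma>\<^sup>2"] sum_distrib_left by simp
  also have "\<dots> \<le> 18 * \<sigma>\<^sup>2 * real k + 576 * \<sigma>\<^sup>2 / \<kappa> * (real k * \<kappa>)"
    using cardI logs \<kappa> by (intro add_mono mult_left_mono) auto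
  also have "\<dots> = 594 * \<sigma>\<^sup>2 * real k" using \<kappa> by simp
  finally show "(\<integral>\<epsilon>. total_noise (4 * \<sigma>\<^sup>2 * ln \<kappa>) k N \<epsilon> \<partial>?P) \<le> 594 * \<sigma>\<^sup>2 * real k"
    by (simp add: t_def)
qed

end

subsection \<open>The risk bound\<close>

text \<open>Young's inequality with the parameter \<open>\<eta>\<close> chosen so that (1 + \<eta>)
  / (1 - \<eta>) = 1 + \<delta>.\<close>

lemma quadratic_self_bound:
  fixes a b S B P \<delta> :: real
  assumes basic: "a \<le> b + 2 * P" and P: "P\<^sup>2 \<le> S * B" and S: "0 \<le> S" "S \<le> 2 * a + 2 * b"
    and B: "0 \<le> B" and \<delta>: "0 < \<delta>"
  shows "a \<le> (1 + \<delta>) * b + (2 + \<delta>)\<^sup>2 / \<delta> * B"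
proof -
  define \<eta> where "\<eta> = \<delta> / (2 + \<delta>)"
  define X where "X = (2 + \<delta>)\<^sup>2 / \<delta> * B"
  have \<eta>: "0 < \<eta>" using \<delta> by (simp add: \<eta>_def)
  have "2 * P \<le> 2 * sqrt (S * B)" using P by (simp add: real_le_rsqrt)
  also have "\<dots> = 2 * (sqrt (\<eta> * S / 2) * sqrt (2 * B / \<eta>))"
    using \<eta> by (simp add: real_sqrt_mult[symmetric])
  also have "\<dots> \<le> \<eta> * S / 2 + 2 * B / \<eta>"
    using sum_squares_bound[of "sqrt (\<eta> * S / 2)" "sqrt (2 * B / \<eta>)"] \<eta> S B by simp
  also have "\<dots> \<le> \<eta> * (a + b) + 2 * B / \<eta>"
    using mult_left_mono[OF S(2), of "\<eta> / 2"] \<eta> by (simp add: algebra_simps)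
  finally have "a \<le> b + \<eta> * (a + b) + 2 * B / \<eta>" using basic by linarith
  then have "(2 + \<delta>) * a \<le> (2 + \<delta>) * (b + \<eta> * (a + b) + 2 * B / \<eta>)"
    using \<delta> by (intro mult_left_mono) auto
  also have "\<dots> = (2 + \<delta>) * b + \<delta> * (a + b) + 2 * ((2 + \<delta>)\<^sup>2 / \<delta> * B)"
  proof -
    have "(2 + \<delta>) * \<eta> = \<delta>" "(2 + \<delta>) / \<eta> = (2 + \<delta>)\<^sup>2 / \<delta>"
      using \<delta> by (simp_all add: \<eta>_def power2_eq_square)
    moreover have "(2 + \<delta>) * (b + \<eta> * (a + b) + 2 * B / \<eta>) =
        (2 + \<delta>) * b + (2 + \<delta>) * \<eta> * (a + b) + 2 * ((2 + \<delta>) / \<eta> * B)"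
      by (simp add: distrib_left mult.assoc mult.left_commute)
    ultimately show ?thesis by simp
  qed
  finally have "(2 + \<delta>) * a \<le> (2 + \<delta>) * b + \<delta> * (a + b) + 2 * X" by (simp only: X_def)
  then have "a \<le> (1 + \<delta>) * b + X" unfolding distrib_left distrib_right by linarith
  then show ?thesis by (simp only: X_def)
qed

lemma sq_dist_triangle: "sq_dist n u v \<le> 2 * sq_dist n u w + 2 * sq_dist n v w"
proof -
  have "(u i - v i)\<^sup>2 \<le> 2 * (u i - w i)\<^sup>2 + 2 * (v i - w i)\<^sup>2" for i
    using zero_le_power2[of "(u i - w i) + (v i - w i)"] by (simp add: power2_eq_square algebra_simps)
  then show ?thesis
    unfolding sq_dist_eq_sum sum_distrib_left sum.distrib[symmetric] by (intro sum_mono)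
qed

text \<open>Purely deterministic: it holds for every noise vector, and the right-hand side is random
  only through \<open>total_noise\<close>.\<close>

lemma least_squares_pointwise_bound:
  assumes T: "is_least_squares n k T" and \<theta>: "\<theta> \<in> Theta_star n k"
    and kn: "knots n k N"
    and zero: "\<And>i x. i \<in> {1..k} \<Longrightarrow> N (i - 1) + 1 < x \<Longrightarrow> x < N i \<Longrightarrow> second_diff \<theta> x = 0"
    and t: "0 \<le> t" and \<delta>: "0 < \<delta>"
  shows "sq_dist n (T (observe n \<theta>\<^sub>0 \<epsilon>)) \<theta>\<^sub>0 \<le> (1 + \<delta>) * sq_dist n \<theta> \<theta>\<^sub>0 +
    (2 + \<delta>)\<^sup>2 / \<delta> * (300000000 * (t * k + total_noise t k N \<epsilon>))"
proof (rule quadratic_self_bound)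
  let ?y = "observe n \<theta>\<^sub>0 \<epsilon>"
  let ?P = "\<Sum>x=1..n. \<epsilon> x * (T ?y x - \<theta> x)"
  have "?y \<in> space (Rn n)" by (simp add: observe_def space_PiM)
  then have min: "is_arg_min (\<lambda>\<theta>. sq_dist n ?y \<theta>) (\<lambda>\<theta>. \<theta> \<in> Theta_star n k) (T ?y)"
    using T by (simp add: is_least_squares_def)
  then have mem: "T ?y \<in> Theta_star n k" by (simp add: is_arg_min_def)
  have "sq_dist n ?y (T ?y) \<le> sq_dist n ?y \<theta>"
    using min \<theta> by (auto simp: is_arg_min_def not_less)
  moreover have "sq_dist n ?y u = sq_dist n u \<theta>\<^sub>0 - 2 * (\<Sum>x=1..n. \<epsilon> x * (u x - \<theta>\<^sub>0 x)) + (\<Sum>x=1..n. (\<epsilon> x)\<^sup>2)" for u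
    unfolding sq_dist_eq_sum sum_distrib_left sum_subtractf[symmetric] sum.distrib[symmetric]
    by (intro sum.cong refl) (simp add: observe_def power2_eq_square algebra_simps)
  moreover have "?P = (\<Sum>x=1..n. \<epsilon> x * (T ?y x - \<theta>\<^sub>0 x)) - (\<Sum>x=1..n. \<epsilon> x * (\<theta> x - \<theta>\<^sub>0 x))"
    unfolding sum_subtractf[symmetric] by (intro sum.cong refl) (simp add: algebra_simps)
  ultimately show "sq_dist n (T ?y) \<theta>\<^sub>0 \<le> sq_dist n \<theta> \<theta>\<^sub>0 + 2 * ?P" by simp
  show "?P\<^sup>2 \<le> sq_dist n (T ?y) \<theta> * (300000000 * (t * k + total_noise t k N \<epsilon>))"
    unfolding sq_dist_eq_sum using mem kn zero t by (rule noise_correlation_bound)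
  show "sq_dist n (T ?y) \<theta> \<le> 2 * sq_dist n (T ?y) \<theta>\<^sub>0 + 2 * sq_dist n \<theta> \<theta>\<^sub>0"
    by (rule sq_dist_triangle)
qed (use t \<delta> in \<open>auto simp: sq_dist_def total_noise_nonneg\<close>)

theorem proposition3p1:
  "\<exists>n\<^sub>0::nat. \<forall>\<delta>::real. \<delta> > 0 \<longrightarrow> (\<exists>C::real. C > 0 \<and>
     (\<forall>n k (\<sigma>::real) \<theta>\<^sub>0 T.
        n \<ge> n\<^sub>0 \<longrightarrow> 2 \<le> k \<longrightarrow> k \<le> n \<longrightarrow> \<sigma> > 0 \<longrightarrow> \<theta>\<^sub>0 \<in> space (Rn n) \<longrightarrow> is_least_squares n k T \<longrightarrow>
          integrable (gaussian_noise n \<sigma>) (\<lambda>\<epsilon>. sq_dist n (T (observe n \<theta>\<^sub>0 \<epsilon>)) \<theta>\<^sub>0) \<and>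
          prob_space.expectation (gaussian_noise n \<sigma>)
              (\<lambda>\<epsilon>. sq_dist n (T (observe n \<theta>\<^sub>0 \<epsilon>)) \<theta>\<^sub>0)
            \<le> (1 + \<delta>) * (INF \<theta>\<in>Theta_star n k. sq_dist n \<theta> \<theta>\<^sub>0)
              + C * \<sigma>\<^sup>2 * real k * ln (ln (16 * real n / real k))))"
proof (rule exI[of _ 0], intro allI impI)
  fix \<delta> :: real assume \<delta>: "0 < \<delta>"
  \<comment> \<open>\<open>c\<close> is the factor of \<open>quadratic_self_bound\<close>. The final
    constant is 300000000 * 1000 * c, where 1000 rounds up 4 + 594 * 3/2 = 895. The lower bound 0
    for \<open>n\<close> suffices, as \<open>2 \<le> k\<close> and \<open>k \<le> n\<close> already
    give every estimate.\<close>
  define c where "c = (2 + \<delta>)\<^sup>2 / \<delta>"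
  have c: "0 < c" using \<delta> by (simp add: c_def)
  have "integrable (gaussian_noise n \<sigma>) (\<lambda>\<epsilon>. sq_dist n (T (observe n \<theta>\<^sub>0 \<epsilon>)) \<theta>\<^sub>0) \<and>
      (\<integral>\<epsilon>. sq_dist n (T (observe n \<theta>\<^sub>0 \<epsilon>)) \<theta>\<^sub>0 \<partial>gaussian_noise n \<sigma>)
        \<le> (1 + \<delta>) * (INF \<theta>\<in>Theta_star n k. sq_dist n \<theta> \<theta>\<^sub>0)
          + (300000000000 * c) * \<sigma>\<^sup>2 * real k * ln (ln (16 * real n / real k))"
    if k: "2 \<le> k" "k \<le> n" and \<sigma>: "0 < \<sigma>" and T: "is_least_squares n k T"
    for n k :: nat and \<sigma> :: real and \<theta>\<^sub>0 T
  proof -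
    let ?P = "gaussian_noise n \<sigma>"
    let ?loss = "\<lambda>\<epsilon>. sq_dist n (T (observe n \<theta>\<^sub>0 \<epsilon>)) \<theta>\<^sub>0"
    define \<kappa> where "\<kappa> = ln (16 * real n / real k)"
    define t where "t = 4 * \<sigma>\<^sup>2 * ln \<kappa>"
    interpret P: prob_space ?P
      unfolding gaussian_noise_def by (intro prob_space_PiM prob_space_normal_density \<sigma>)
    \<comment> \<open>The 16 keeps \<open>\<kappa>\<close> above 2, hence \<open>ln \<kappa>\<close>
      above 2/3, so that terms of order sigma^2 k are absorbed into the iterated logarithm even at
      \<open>k = n\<close>.\<close>
    have "ln (2 ^ 4) = 4 * ln (2::real)" by (subst ln_realpow) auto
    then have "2 \<le> ln (16::real)" using ln2_ge_two_thirds by simp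
    also have "ln 16 \<le> \<kappa>" using k by (simp add: \<kappa>_def field_simps)
    finally have "ln 2 \<le> ln \<kappa>" by simp
    then have ln\<kappa>: "2 / 3 \<le> ln \<kappa>" using ln2_ge_two_thirds by linarith
    have t: "0 \<le> t" using ln\<kappa> by (simp add: t_def)
    have sets_P: "sets ?P = sets (Rn n)"
      unfolding gaussian_noise_def by (intro sets_PiM_cong) auto
    have coord: "(\<lambda>\<epsilon>. \<epsilon> i) \<in> borel_measurable ?P" if "i \<in> {1..n}" for i
      using measurable_component_singleton[OF that, of "\<lambda>_. borel"] sets_P
      by (simp cong: measurable_cong_sets)
    have "observe n \<theta>\<^sub>0 \<in> ?P \<rightarrow>\<^sub>M Rn n"
      unfolding observe_def using coord by (intro measurable_restrict borel_measurable_add) auto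
    moreover have "T \<in> Rn n \<rightarrow>\<^sub>M Rn n" using T by (simp add: is_least_squares_def)
    ultimately have TO: "(\<lambda>\<epsilon>. T (observe n \<theta>\<^sub>0 \<epsilon>)) \<in> ?P \<rightarrow>\<^sub>M Rn n" by (rule measurable_compose)
    have "(\<lambda>\<epsilon>. T (observe n \<theta>\<^sub>0 \<epsilon>) i) \<in> borel_measurable ?P" if "i \<in> {1..n}" for i
      using measurable_compose[OF TO measurable_component_singleton[OF that]] .
    then have loss_meas: "?loss \<in> borel_measurable ?P"
      unfolding sq_dist_eq_sum by (intro borel_measurable_sum borel_measurable_power borel_measurable_diff) auto
    have risk: "integrable ?P ?loss \<and>
        (\<integral>\<epsilon>. ?loss \<epsilon> \<partial>?P) \<le> (1 + \<delta>) * sq_dist n \<theta> \<theta>\<^sub>0 + 300000000000 * c * \<sigma>\<^sup>2 * real k * ln \<kappa>"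
      if \<theta>: "\<theta> \<in> Theta_star n k" for \<theta>
    proof -
      obtain N where kn: "knots n k N" and zero:
        "\<And>i x. i \<in> {1..k} \<Longrightarrow> N (i - 1) + 1 < x \<Longrightarrow> x < N i \<Longrightarrow> second_diff \<theta> x = 0"
        using Theta_star_second_diff_zero[OF \<theta>] by blast
      let ?g = "\<lambda>\<epsilon>. (1 + \<delta>) * sq_dist n \<theta> \<theta>\<^sub>0 + c * (300000000 * (t * k + total_noise t k N \<epsilon>))"
      have le: "?loss \<epsilon> \<le> ?g \<epsilon>" for \<epsilon>
        unfolding c_def using T \<theta> kn zero t \<delta> by (rule least_squares_pointwise_bound)
      have loss0: "0 \<le> ?loss \<epsilon>" for \<epsilon> by (simp add: sq_dist_def)
      have noise: "integrable ?P (total_noise t k N)" "(\<integral>\<epsilon>. total_noise t k N \<epsilon> \<partial>?P) \<le> 594 * \<sigma>\<^sup>2 * real k"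
        unfolding t_def \<kappa>_def using k by (intro expectation_total_noise \<sigma> kn; simp)+
      have g: "integrable ?P ?g" using noise(1) by simp
      have int: "integrable ?P ?loss"
      proof (rule Bochner_Integration.integrable_bound[OF g loss_meas])
        show "AE \<epsilon> in ?P. norm (?loss \<epsilon>) \<le> norm (?g \<epsilon>)"
          using le loss0 by (intro AE_I2) (metis abs_of_nonneg order_trans real_norm_def)
      qed
      have "(\<integral>\<epsilon>. ?loss \<epsilon> \<partial>?P) \<le> (\<integral>\<epsilon>. ?g \<epsilon> \<partial>?P)"
        using int g le by (intro integral_mono) auto
      also have "\<dots> = (1 + \<delta>) * sq_dist n \<theta> \<theta>\<^sub>0 + c * (300000000 * (t * k + (\<integral>\<epsilon>. total_noise t k N \<epsilon> \<partial>?P)))"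
        using noise(1) by (simp add: P.prob_space)
      also have "\<dots> \<le> (1 + \<delta>) * sq_dist n \<theta> \<theta>\<^sub>0 + c * (300000000 * (1000 * \<sigma>\<^sup>2 * real k * ln \<kappa>))"
      proof (intro add_left_mono mult_left_mono)
        have "594 * \<sigma>\<^sup>2 * real k \<le> 594 * \<sigma>\<^sup>2 * real k * (3 / 2 * ln \<kappa>)"
          using mult_left_mono[of 1 "3 / 2 * ln \<kappa>" "594 * \<sigma>\<^sup>2 * real k"] ln\<kappa> by simp
        then have "t * k + (\<integral>\<epsilon>. total_noise t k N \<epsilon> \<partial>?P) \<le> 895 * (\<sigma>\<^sup>2 * real k * ln \<kappa>)"
          using noise(2) by (simp add: t_def algebra_simps)
        also have "\<dots> \<le> 1000 * (\<sigma>\<^sup>2 * real k * ln \<kappa>)"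
          using ln\<kappa> by (intro mult_right_mono mult_nonneg_nonneg) auto
        finally show "t * k + (\<integral>\<epsilon>. total_noise t k N \<epsilon> \<partial>?P) \<le> 1000 * \<sigma>\<^sup>2 * real k * ln \<kappa>" by simp
      qed (use c in auto)
      finally show ?thesis using int by (simp add: mult_ac)
    qed
    \<comment> \<open>The infimum of an empty set of reals would carry no information; the value of
      \<open>T\<close> at any observation shows that the class is inhabited.\<close>
    have "(\<lambda>i\<in>{1..n}. 0) \<in> space (Rn n)" by (simp add: space_PiM)
    then have ne: "Theta_star n k \<noteq> {}" using T by (auto simp: is_least_squares_def is_arg_min_def)
    let ?E = "\<integral>\<epsilon>. ?loss \<epsilon> \<partial>?P"
    let ?r = "300000000000 * c * \<sigma>\<^sup>2 * real k * ln \<kappa>"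
    \<comment> \<open>The risk bound holds for each fixed comparison vector, so solving it for
      \<open>sq_dist\<close> gives a common lower bound; the infimum need not be attained.\<close>
    have "(?E - ?r) / (1 + \<delta>) \<le> (INF \<theta>\<in>Theta_star n k. sq_dist n \<theta> \<theta>\<^sub>0)"
    proof (rule cINF_greatest[OF ne])
      fix \<theta> assume "\<theta> \<in> Theta_star n k"
      then have "?E - ?r \<le> sq_dist n \<theta> \<theta>\<^sub>0 * (1 + \<delta>)" using risk[of \<theta>] by (simp add: mult.commute)
      then show "(?E - ?r) / (1 + \<delta>) \<le> sq_dist n \<theta> \<theta>\<^sub>0" using \<delta> by (simp add: divide_le_eq)
    qed
    then have "?E - ?r \<le> (INF \<theta>\<in>Theta_star n k. sq_dist n \<theta> \<theta>\<^sub>0) * (1 + \<delta>)"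
      using \<delta> by (simp add: divide_le_eq)
    then have "?E \<le> (1 + \<delta>) * (INF \<theta>\<in>Theta_star n k. sq_dist n \<theta> \<theta>\<^sub>0) + ?r"
      by (simp add: mult.commute)
    moreover have "integrable ?P ?loss"
      using risk ne by auto
    ultimately show ?thesis by (simp only: \<kappa>_def simp_thms)
  qed
  then show "\<exists>C::real. C > 0 \<and>
     (\<forall>n k (\<sigma>::real) \<theta>\<^sub>0 T.
        n \<ge> 0 \<longrightarrow> 2 \<le> k \<longrightarrow> k \<le> n \<longrightarrow> \<sigma> > 0 \<longrightarrow> \<theta>\<^sub>0 \<in> space (Rn n) \<longrightarrow> is_least_squares n k T \<longrightarrow>
          integrable (gaussian_noise n \<sigma>) (\<lambda>\<epsilon>. sq_dist n (T (observe n \<theta>\<^sub>0 \<epsilon>)) \<theta>\<^sub>0) \<and>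
          prob_space.expectation (gaussian_noise n \<sigma>)
              (\<lambda>\<epsilon>. sq_dist n (T (observe n \<theta>\<^sub>0 \<epsilon>)) \<theta>\<^sub>0)
            \<le> (1 + \<delta>) * (INF \<theta>\<in>Theta_star n k. sq_dist n \<theta> \<theta>\<^sub>0)
              + C * \<sigma>\<^sup>2 * real k * ln (ln (16 * real n / real k)))"
    using c by (intro exI[of _ "300000000000 * c"] conjI[of "0 < 300000000000 * c"] allI impI) simp_all
qed

end
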